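(* Let $\Gamma$ be a finite graph. The following posets are isomorphic: (1) the poset $\mathcal{OP}_\Gamma$ of totally cyclic orientations; (2) the poset of faces of the Voronoi polytope $\operatorname{Vor}_\Gamma$, ordered by reverse inclusion; (3) the poset of cones in the normal fan $\mathcal N(\operatorname{Vor}_\Gamma)$, ordered by inclusion; (4) the poset of cones in the cographic fan $\mathcal F_\Gamma^\perp$, ordered by inclusion.
   Context: Graphs. A finite graph $\Gamma$ consists of finite sets $V(\Gamma)$ (vertices) and $\overset{\rightarrow}{E}(\Gamma)$ (oriented edges), a fixed-point-free involution $\iota$ of $\overset{\rightarrow}{E}(\Gamma)$, and source and target maps $s,t:\overset{\rightarrow}{E}(\Gamma)\to V(\Gamma)$ with $s(\vec e)=t(\iota(\vec e))$ (loops and multiple edges allowed). $E(\Gamma):=\overset{\rightarrow}{E}(\Gamma)/\iota$; the two orientations of an edge $e$ are $\overset{\rightarrow}{e}$ and $\overset{\leftarrow}{e}$. An orientation of $\Gamma$ is a section $\phi:E(\Gamma)\to\overset{\rightarrow}{E}(\Gamma)$ of the quotient map. For $S\subseteq E(\Gamma)$, $\Gamma\setminus S$ is obtained by removing the edges in $S$ and keeping all vertices. Totally cyclic orientations. If $\Gamma$ is connected, an orientation $\phi$ is totally cyclic if there is no non-empty proper subset $W\subset V(\Gamma)$ such that every edge between $W$ and $V(\Gamma)\setminus W$ is oriented from $W$ to $V(\Gamma)\setminus W$; in general $\phi$ is totally cyclic if its restriction to each connected component is (the empty orientation of a graph without edges is totally cyclic). $\mathcal{OP}_\Gamma$ is the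 set of pairs $(T,\phi)$ with $T\subseteq E(\Gamma)$ and $\phi$ a totally cyclic orientation of $\Gamma\setminus T$, with $(T',\phi')\le(T,\phi)$ iff $T\subseteq T'$ and $\phi'=\phi|_{E(\Gamma\setminus T')}$. Homology. $\overset{\rightarrow}{C}_1(\Gamma,A)$ is the $A$-module generated by $\overset{\rightarrow}{E}(\Gamma)$ with relations $\overset{\leftarrow}{e}=-\overset{\rightarrow}{e}$; $\partial(\overset{\rightarrow}{e})=t(\overset{\rightarrow}{e})-s(\overset{\rightarrow}{e})$; $H_1(\Gamma,A)=\ker\partial$. The positive definite bilinear form on $\overset{\rightarrow}{C}_1(\Gamma,\mathbb R)$, restricted to $H_1(\Gamma,\mathbb R)$, is determined by $(\overset{\rightarrow}{e},\overset{\rightarrow}{e})=1$, $(\overset{\rightarrow}{e},\overset{\leftarrow}{e})=-1$, $(\overset{\rightarrow}{e},\overset{\rightarrow}{f})=0$ for $f\ne e$. Cographic fan. The cographic arrangement is the set of hyperplanes $\{v\in H_1(\Gamma,\mathbb R):(v,e)=0\}$ for those $e\in E(\Gamma)$ with $(\cdot,e)\not\equiv0$ on $H_1(\Gamma,\mathbb R)$. The cographic fan $\mathcal F_\Gamma^\perp$ consists of the closures of the connected components of its complement in $H_1(\Gamma,\mathbb R)$ and all their faces. Voronoi polytope. $\operatorname{Vor}_\Gamma=\{v\in H_1(\Gamma,\mathbb R):(v,v)\le(v-\lambda,v-\lambda)\ \forall\lambda\in H_1(\Gamma,\mathbb Z)\}$. "Faces" means non-empty faces, including $\operatorname{Vor}_\Gamma$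 itself. For a face $\delta$, $C_\delta=\{\alpha\in H_1(\Gamma,\mathbb R):(\alpha,r)\ge(\alpha,r')\ \forall r\in\delta,\ r'\in\operatorname{Vor}_\Gamma\}$; the normal fan $\mathcal N(\operatorname{Vor}_\Gamma)$ is the fan whose cones are the $C_\delta$. *)

theory Defs
  imports "HOL-Analysis.Analysis" "Graph_Theory.Digraph_Component"
begin

section \<open>Graphs and totally cyclic orientations\<close>

text \<open>
  A finite graph is a \<^locale>\<open>fin_digraph\<close>, whose arcs are the oriented edges (source
  \<^const>\<open>tail\<close>, target \<^const>\<open>head\<close>), together with an involution \<open>\<iota>\<close> making it a
  \<^locale>\<open>bidirected_digraph\<close>; the latter normalises \<open>\<iota>\<close> to be the identity outside the arcs.
\<close>

definition edges :: "('v, 'e) pre_digraph \<Rightarrow> ('e \<Rightarrow> 'e) \<Rightarrow> 'e set set" where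
  "edges G \<iota> = (\<lambda>a. {a, \<iota> a}) ` arcs G"

text \<open>Orientations are extensional, so that two orientations are equal iff they agree on all edges.\<close>

definition orientations :: "('v, 'e) pre_digraph \<Rightarrow> ('e \<Rightarrow> 'e) \<Rightarrow> ('e set \<Rightarrow> 'e) set" where
  "orientations G \<iota> = (\<Pi>\<^sub>E x\<in>edges G \<iota>. x)"

definition delete_edges :: "('v, 'e) pre_digraph \<Rightarrow> 'e set set \<Rightarrow> ('v, 'e) pre_digraph" where
  "delete_edges G S = G\<lparr>arcs := arcs G - \<Union>S\<rparr>"

lemma (in bidirected_digraph) edges_delete_edges:
  assumes "S \<subseteq> edges G arev"
  shows "edges (delete_edges G S) arev = edges G arev - S"
proof -
  have "{a, arev a} \<in> S" if "a \<in> \<Union>S" for a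
    using that assms by (auto simp: edges_def insert_commute)
  then show ?thesis
    by (auto simp: edges_def delete_edges_def)
qed

definition edge_between :: "('v, 'e) pre_digraph \<Rightarrow> 'e set \<Rightarrow> 'v set \<Rightarrow> 'v set \<Rightarrow> bool" where
  "edge_between G x W W' \<longleftrightarrow> (\<exists>a\<in>x. tail G a \<in> W \<and> head G a \<in> W')"

definition totally_cyclic_connected ::
    "('v, 'e) pre_digraph \<Rightarrow> ('e \<Rightarrow> 'e) \<Rightarrow> ('e set \<Rightarrow> 'e) \<Rightarrow> bool" where
  "totally_cyclic_connected K \<iota> \<phi> \<longleftrightarrow>
    \<not> (\<exists>W. W \<noteq> {} \<and> W \<subset> verts K \<and>
        (\<forall>x\<in>edges K \<iota>. edge_between K x W (verts K - W) \<longrightarrow>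
           tail K (\<phi> x) \<in> W \<and> head K (\<phi> x) \<in> verts K - W))"

text \<open>
  \<open>max_subgraph connected\<close> describes the connected components; the qualifier distinguishes graph
  connectedness from topological connectedness.
\<close>

definition totally_cyclic ::
    "('v, 'e) pre_digraph \<Rightarrow> ('e \<Rightarrow> 'e) \<Rightarrow> ('e set \<Rightarrow> 'e) \<Rightarrow> bool" where
  "totally_cyclic G \<iota> \<phi> \<longleftrightarrow>
    (\<forall>K. pre_digraph.max_subgraph G Digraph_Component.connected K \<longrightarrow>
       totally_cyclic_connected K \<iota> (restrict \<phi> (edges K \<iota>)))"

definition OP ::
    "('v, 'e) pre_digraph \<Rightarrow> ('e \<Rightarrow> 'e) \<Rightarrow> ('e set set \<times> ('e set \<Rightarrow> 'e)) set" where
  "OP G \<iota> = {(T, \<phi>). T \<subseteq> edges G \<iota> \<and> \<phi> \<in> orientations (delete_edges G T) \<iota> \<and>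
                    totally_cyclic (delete_edges G T) \<iota> \<phi>}"

definition OP_le :: "('v, 'e) pre_digraph \<Rightarrow> ('e \<Rightarrow> 'e) \<Rightarrow>
    'e set set \<times> ('e set \<Rightarrow> 'e) \<Rightarrow> 'e set set \<times> ('e set \<Rightarrow> 'e) \<Rightarrow> bool" where
  "OP_le G \<iota> = (\<lambda>(T', \<phi>') (T, \<phi>). T \<subseteq> T' \<and> \<phi>' = restrict \<phi> (edges (delete_edges G T') \<iota>))"

lemma OP_le_partial_order:
  "partial_order_on (OP G \<iota>) {(p, q) \<in> OP G \<iota> \<times> OP G \<iota>. OP_le G \<iota> p q}"
proof -
  have restr: "restrict \<phi> (edges (delete_edges G T) \<iota>) = \<phi>" if "(T, \<phi>) \<in> OP G \<iota>" for T \<phi>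
    using that by (auto simp: OP_def orientations_def intro!: PiE_restrict)
  have mono: "edges (delete_edges G T) \<iota> \<subseteq> edges (delete_edges G T') \<iota>" if "T' \<subseteq> T" for T T'
    using that by (auto simp: edges_def delete_edges_def)
  show ?thesis
    unfolding partial_order_on_def preorder_on_def
  proof (intro conjI)
    show "refl_on (OP G \<iota>) {(p, q) \<in> OP G \<iota> \<times> OP G \<iota>. OP_le G \<iota> p q}"
      by (auto simp: refl_on_def OP_le_def restr)
    show "antisym {(p, q) \<in> OP G \<iota> \<times> OP G \<iota>. OP_le G \<iota> p q}"
      by (rule antisymI) (auto simp: OP_le_def restr)
    show "trans {(p, q) \<in> OP G \<iota> \<times> OP G \<iota>. OP_le G \<iota> p q}"
      by (rule transI) (use mono in \<open>auto simp: OP_le_def Int_absorb1 Int_absorb2\<close>)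
  qed auto
qed

section \<open>Chains and homology\<close>

text \<open>
  The module of 1-chains with coefficients in \<open>A\<close> (used for \<open>A = \<int>\<close> and \<open>A = \<real>\<close>) is realised
  inside \<open>\<real>\<close>-valued functions on the oriented edges: the class of \<open>\<Sum>a. c a \<cdot> a\<close> modulo the relations
  \<open>\<iota> a = - a\<close> corresponds to the antisymmetric function \<open>a \<mapsto> c a - c (\<iota> a)\<close>. In particular
  the generator given by the oriented edge \<open>a\<close> becomes \<open>dart \<iota> a\<close>. The type of oriented edges is
  finite, but the arcs of a graph may form any subset of it.
\<close>

definition chains :: "('v, 'e::finite) pre_digraph \<Rightarrow> ('e \<Rightarrow> 'e) \<Rightarrow> real set \<Rightarrow> (real ^ 'e) set" where
  "chains G \<iota> A = {c. (\<forall>a. c $ a \<in> A) \<and> (\<forall>a\<in>arcs G. c $ \<iota> a = - c $ a) \<and> (\<forall>a. a \<notin> arcs G \<longrightarrow> c $ a = 0)}"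

definition dart :: "('e \<Rightarrow> 'e) \<Rightarrow> 'e \<Rightarrow> real ^ 'e::finite" where
  "dart \<iota> a = axis a 1 - axis (\<iota> a) 1"

text \<open>The factor 1/2 compensates for each edge being counted with both of its orientations.\<close>

definition boundary :: "('v, 'e::finite) pre_digraph \<Rightarrow> real ^ 'e \<Rightarrow> 'v \<Rightarrow> real" where
  "boundary G c v = (1/2) * (\<Sum>a\<in>arcs G. c $ a * (of_bool (head G a = v) - of_bool (tail G a = v)))"

definition form :: "real ^ 'e::finite \<Rightarrow> real ^ 'e \<Rightarrow> real" where
  "form x y = (1/2) * (x \<bullet> y)"

definition H1 :: "('v, 'e::finite) pre_digraph \<Rightarrow> ('e \<Rightarrow> 'e) \<Rightarrow> real set \<Rightarrow> (real ^ 'e) set" where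
  "H1 G \<iota> A = {c \<in> chains G \<iota> A. \<forall>v\<in>verts G. boundary G c v = 0}"

context
  fixes G :: "('v, 'e::finite) pre_digraph" and \<iota>
  assumes G: "bidirected_digraph G \<iota>"
begin

interpretation bidirected_digraph G \<iota> by (rule G)

lemma arev_inject: "\<iota> a = \<iota> b \<Longrightarrow> a = b"
  by (metis arev_arev)

lemma dart_in_chains: "a \<in> arcs G \<Longrightarrow> dart \<iota> a \<in> chains G \<iota> \<int>"
  using arev_dom by (auto simp: dart_def chains_def axis_def dest: arev_inject)

lemma dart_reverse: "dart \<iota> (\<iota> a) = - dart \<iota> a"
  by (simp add: dart_def)

text \<open>A choice of one orientation per edge yields a basis of the 1-chains.\<close>

lemma chain_eq_sum_darts:
  assumes "c \<in> chains G \<iota> A" and "\<phi> \<in> orientations G \<iota>"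
  shows "c = (\<Sum>x\<in>edges G \<iota>. (c $ \<phi> x) *\<^sub>R dart \<iota> (\<phi> x))"
proof (rule vec_eq_iff[THEN iffD2, rule_format])
  fix b
  have phi: "\<phi> {a, \<iota> a} = a \<or> \<phi> {a, \<iota> a} = \<iota> a" if "a \<in> arcs G" for a
    using assms(2) that by (auto simp: orientations_def edges_def PiE_def Pi_def)
  have edge: "x = {b, \<iota> b}" if "x \<in> edges G \<iota>" "b \<in> x" for x
    using that by (auto simp: edges_def)
  have zero: "dart \<iota> (\<phi> x) $ b = 0" if x: "x \<in> edges G \<iota>" "b \<notin> x" for x
  proof -
    obtain a where a: "a \<in> arcs G" "x = {a, \<iota> a}" using x by (auto simp: edges_def)
    then show ?thesis using phi[OF a(1)] x by (auto simp: dart_def axis_def)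
  qed
  show "c $ b = (\<Sum>x\<in>edges G \<iota>. (c $ \<phi> x) *\<^sub>R dart \<iota> (\<phi> x)) $ b"
  proof (cases "b \<in> arcs G")
    case True
    have "(\<Sum>x\<in>edges G \<iota>. (c $ \<phi> x) *\<^sub>R dart \<iota> (\<phi> x)) $ b
        = (\<Sum>x\<in>{{b, \<iota> b}}. c $ \<phi> x * dart \<iota> (\<phi> x) $ b)"
      unfolding sum_component vector_scaleR_component real_scaleR_def
      using True zero edge by (intro sum.mono_neutral_right) (auto simp: edges_def)
    also have "\<dots> = c $ b"
      using phi[OF True] assms(1) True arev_neq[OF True]
      by (auto simp: dart_def axis_def chains_def)
    finally show ?thesis by simp
  next
    case False
    have "b \<notin> x" if "x \<in> edges G \<iota>" for x
      using that False by (auto simp: edges_def)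
    then show ?thesis
      using assms(1) False zero by (auto simp: sum_component chains_def)
  qed
qed

lemma boundary_dart:
  assumes "a \<in> arcs G"
  shows "boundary G (dart \<iota> a) v = of_bool (head G a = v) - of_bool (tail G a = v)"
proof -
  have "boundary G (dart \<iota> a) v =
      (1/2) * (\<Sum>b\<in>{a, \<iota> a}. dart \<iota> a $ b * (of_bool (head G b = v) - of_bool (tail G b = v)))"
    unfolding boundary_def using assms
    by (intro arg_cong[where f = "(*) (1/2)"] sum.mono_neutral_right) (auto simp: dart_def axis_def)
  also have "\<dots> = of_bool (head G a = v) - of_bool (tail G a = v)"
    using assms arev_neq[OF assms] arev_neq[OF assms, symmetric]
    by (simp add: dart_def axis_def)
  finally show ?thesis .
qed

lemma form_dart:
  assumes "a \<in> arcs G" "b \<in> arcs G"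
  shows "form (dart \<iota> a) (dart \<iota> b) = (if b = a then 1 else if b = \<iota> a then - 1 else 0)"
  using assms arev_neq[of a] arev_neq[of b]
  by (auto simp: form_def dart_def inner_diff_left inner_diff_right inner_axis_axis dest: arev_inject)

end

section \<open>The cographic fan and the Voronoi polytope\<close>

definition cographic_arrangement ::
    "('v, 'e::finite) pre_digraph \<Rightarrow> ('e \<Rightarrow> 'e) \<Rightarrow> (real ^ 'e) set set" where
  "cographic_arrangement G \<iota> =
    {{v \<in> H1 G \<iota> UNIV. form v (dart \<iota> a) = 0} | a.
       a \<in> arcs G \<and> (\<exists>v\<in>H1 G \<iota> UNIV. form v (dart \<iota> a) \<noteq> 0)}"

definition cographic_fan :: "('v, 'e::finite) pre_digraph \<Rightarrow> ('e \<Rightarrow> 'e) \<Rightarrow> (real ^ 'e) set set" where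
  "cographic_fan G \<iota> =
    {F. F \<noteq> {} \<and>
        (\<exists>C\<in>components (H1 G \<iota> UNIV - \<Union>(cographic_arrangement G \<iota>)). F face_of closure C)}"

definition Vor :: "('v, 'e::finite) pre_digraph \<Rightarrow> ('e \<Rightarrow> 'e) \<Rightarrow> (real ^ 'e) set" where
  "Vor G \<iota> = {v \<in> H1 G \<iota> UNIV. \<forall>l\<in>H1 G \<iota> \<int>. form v v \<le> form (v - l) (v - l)}"

definition Vor_faces :: "('v, 'e::finite) pre_digraph \<Rightarrow> ('e \<Rightarrow> 'e) \<Rightarrow> (real ^ 'e) set set" where
  "Vor_faces G \<iota> = {\<delta>. \<delta> \<noteq> {} \<and> \<delta> face_of Vor G \<iota>}"

definition normal_cone ::
    "('v, 'e::finite) pre_digraph \<Rightarrow> ('e \<Rightarrow> 'e) \<Rightarrow> (real ^ 'e) set \<Rightarrow> (real ^ 'e) set" where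
  "normal_cone G \<iota> \<delta> = {\<alpha> \<in> H1 G \<iota> UNIV. \<forall>r\<in>\<delta>. \<forall>r'\<in>Vor G \<iota>. form \<alpha> r \<ge> form \<alpha> r'}"

definition normal_fan :: "('v, 'e::finite) pre_digraph \<Rightarrow> ('e \<Rightarrow> 'e) \<Rightarrow> (real ^ 'e) set set" where
  "normal_fan G \<iota> = normal_cone G \<iota> ` Vor_faces G \<iota>"

section \<open>Isomorphism of posets\<close>

definition poset_isomorphic ::
    "'a set \<Rightarrow> ('a \<Rightarrow> 'a \<Rightarrow> bool) \<Rightarrow> 'b set \<Rightarrow> ('b \<Rightarrow> 'b \<Rightarrow> bool) \<Rightarrow> bool" where
  "poset_isomorphic P leP Q leQ \<longleftrightarrow>
    (\<exists>f. bij_betw f P Q \<and> (\<forall>x\<in>P. \<forall>y\<in>P. leP x y \<longleftrightarrow> leQ (f x) (f y)))"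

end

(*
  All four posets are isomorphic to the set of sign patterns pos_arcs c = {a. c a > 0} of flows
  c in H_1(R), ordered by inclusion.

  Orientations: an orientation is totally cyclic iff it is the sign pattern of a flow.  If it is
  one, no cut can be crossed in one direction only.  Conversely, the vertices that receive a unit
  of oriented flow from the head of an oriented arc a form a set closed under oriented arcs, hence
  contain the tail of a, and this closes up to a flow through a.

  Voronoi polytope: it is the orthogonal projection of the cube [-1/2, 1/2]^E.  Both have support
  function c |-> |c|_1 / 2 on H_1(R): for the cube this is clear, for the Voronoi polytope it
  follows by writing c as a sign-compatible nonnegative combination of cycles z with coefficients
  in {-1, 0, 1}, for which (z, z) = |z|_1.  The face maximising c, and its normal cone
  {b. pos_arcs b <= pos_arcs c}, can then be read off the cube.

  Cographic fan: the chambers are the sets of flows with a given maximal sign pattern, and the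
  faces of their closures are again the cones {b. pos_arcs b <= pos_arcs c}.
*)
theory Submission
  imports Defs
begin

section \<open>Isomorphisms of posets\<close>

text \<open>Injectivity comes for free: at a common value \<open>f x = f y\<close>, reflexivity of
  \<open>leQ\<close> gives \<open>leP\<close> in both directions, and antisymmetry identifies the
  two points.\<close>

lemma poset_isomorphicI:
  assumes "f ` P = Q"
    and "\<And>x y. x \<in> P \<Longrightarrow> y \<in> P \<Longrightarrow> leP x y \<longleftrightarrow> leQ (f x) (f y)"
    and "\<And>x y. x \<in> P \<Longrightarrow> y \<in> P \<Longrightarrow> leP x y \<Longrightarrow> leP y x \<Longrightarrow> x = y"
    and "\<And>y. y \<in> Q \<Longrightarrow> leQ y y"
  shows "poset_isomorphic P leP Q leQ"
proof -
  have "inj_on f P"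
    using assms(1,2,3,4) by (intro inj_onI) (metis imageI)
  then show ?thesis
    unfolding poset_isomorphic_def bij_betw_def using assms(1,2) by blast
qed

lemma poset_isomorphic_sym:
  assumes "poset_isomorphic P leP Q leQ"
  shows "poset_isomorphic Q leQ P leP"
proof -
  obtain f where f: "bij_betw f P Q" and le: "\<forall>x\<in>P. \<forall>y\<in>P. leP x y \<longleftrightarrow> leQ (f x) (f y)"
    using assms unfolding poset_isomorphic_def by (elim exE conjE)
  have "leQ x y \<longleftrightarrow> leP (inv_into P f x) (inv_into P f y)" if "x \<in> Q" "y \<in> Q" for x y
    using le that f by (simp add: bij_betw_def bij_betw_inv_into_right[OF f] inv_into_into)
  then show ?thesis
    unfolding poset_isomorphic_def
    by (intro exI[of _ "inv_into P f"] conjI ballI bij_betw_inv_into f)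
qed

lemma poset_isomorphic_trans:
  assumes "poset_isomorphic P leP Q leQ" and "poset_isomorphic Q leQ R leR"
  shows "poset_isomorphic P leP R leR"
proof -
  obtain f where f: "bij_betw f P Q" "\<forall>x\<in>P. \<forall>y\<in>P. leP x y \<longleftrightarrow> leQ (f x) (f y)"
    using assms(1) unfolding poset_isomorphic_def by (elim exE conjE)
  obtain g where g: "bij_betw g Q R" "\<forall>x\<in>Q. \<forall>y\<in>Q. leQ x y \<longleftrightarrow> leR (g x) (g y)"
    using assms(2) unfolding poset_isomorphic_def by (elim exE conjE)
  have "leP x y \<longleftrightarrow> leR ((g \<circ> f) x) ((g \<circ> f) y)" if "x \<in> P" "y \<in> P" for x y
    using that f(2) g(2) bij_betwE[OF f(1)] by simp
  then show ?thesis
    unfolding poset_isomorphic_def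
    by (intro exI[of _ "g \<circ> f"] conjI ballI bij_betw_trans[OF f(1) g(1)])
qed

section \<open>Connectedness\<close>

text \<open>Brings connectedness into the cut form in which total cyclicity is phrased. A walk
  cannot leave a set that no arc crosses; conversely, the vertices reachable from \<open>u\<close>
  form such a set.\<close>

lemma connected_iff_cut:
  assumes "wf_digraph K"
  shows "Digraph_Component.connected K \<longleftrightarrow> verts K \<noteq> {} \<and>
    (\<forall>W. W \<noteq> {} \<longrightarrow> W \<subset> verts K \<longrightarrow> (\<exists>a\<in>arcs K. tail K a \<in> W \<longleftrightarrow> head K a \<notin> W))"
    (is "_ \<longleftrightarrow> _ \<and> ?cut")
proof -
  interpret wf_digraph K by fact
  let ?R = "rtrancl_on (verts K) ((arcs_ends K)\<^sup>s)"
  have step: "(x, y) \<in> (arcs_ends K)\<^sup>s \<longleftrightarrow>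
      (\<exists>a\<in>arcs K. x = tail K a \<and> y = head K a \<or> x = head K a \<and> y = tail K a)" for x y
    by (auto simp: symcl_def arcs_ends_conv)
  have "?cut" if R: "\<forall>u\<in>verts K. \<forall>v\<in>verts K. (u, v) \<in> ?R"
  proof (intro allI impI)
    fix W assume W: "W \<noteq> {}" "W \<subset> verts K"
    then obtain u v where uv: "u \<in> W" "v \<in> verts K - W" by blast
    then have "(u, v) \<in> ?R" using R W by blast
    then show "\<exists>a\<in>arcs K. tail K a \<in> W \<longleftrightarrow> head K a \<notin> W"
    proof (rule contrapos_pp)
      assume no: "\<not> (\<exists>a\<in>arcs K. tail K a \<in> W \<longleftrightarrow> head K a \<notin> W)"
      have "v' \<in> W" if "(u, v') \<in> ?R" for v'
        using that by (induction rule: rtrancl_on_induct) (use uv no in \<open>auto simp: step\<close>)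
      then show "(u, v) \<notin> ?R" using uv by blast
    qed
  qed
  moreover have "(u, v) \<in> ?R" if cut: ?cut and uv: "u \<in> verts K" "v \<in> verts K" for u v
  proof (rule ccontr)
    assume n: "(u, v) \<notin> ?R"
    let ?W = "{w \<in> verts K. (u, w) \<in> ?R}"
    have "?W \<subset> verts K" "?W \<noteq> {}" using n uv by auto
    then have "\<exists>a\<in>arcs K. tail K a \<in> ?W \<longleftrightarrow> head K a \<notin> ?W"
      using cut by (elim allE[of _ ?W]) simp
    then obtain a where a: "a \<in> arcs K" "tail K a \<in> ?W \<longleftrightarrow> head K a \<notin> ?W"
      by (elim bexE)
    then have "tail K a \<in> verts K" "head K a \<in> verts K"
      "(tail K a, head K a) \<in> (arcs_ends K)\<^sup>s" "(head K a, tail K a) \<in> (arcs_ends K)\<^sup>s"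
      using step by auto
    then show False
      using a(2) by (auto intro: rtrancl_on_into_rtrancl_on)
  qed
  ultimately have "(\<forall>u\<in>verts K. \<forall>v\<in>verts K. (u, v) \<in> ?R) \<longleftrightarrow> ?cut"
    by (intro iffI ballI) assumption+
  then show ?thesis
    unfolding connected_conv by (rule arg_cong)
qed

text \<open>The component of \<open>u\<close> is induced on the smallest vertex set \<open>S\<close>
  that contains \<open>u\<close> and is crossed by no arc of \<open>D\<close>.\<close>

lemma ex_max_connected_subgraph:
  assumes "wf_digraph D" and sym: "\<And>a. a \<in> arcs D \<Longrightarrow> r a \<in> arcs D"
    and "\<And>a. a \<in> arcs D \<Longrightarrow> tail D (r a) = head D a" "\<And>a. a \<in> arcs D \<Longrightarrow> head D (r a) = tail D a"
    and u: "u \<in> verts D"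
  obtains K where "pre_digraph.max_subgraph D Digraph_Component.connected K" "u \<in> verts K"
proof -
  interpret wf_digraph D by fact
  define stable where "stable W \<longleftrightarrow> (\<forall>a\<in>arcs D. tail D a \<in> W \<longleftrightarrow> head D a \<in> W)" for W
  define S where "S = \<Inter>{W. u \<in> W \<and> W \<subseteq> verts D \<and> stable W}"
  have S: "u \<in> S" "S \<subseteq> verts D" "stable S"
    using u unfolding S_def stable_def by (auto 0 3)
  have S_least: "S \<subseteq> W" if "u \<in> W" "W \<subseteq> verts D" "stable W" for W
    using that unfolding S_def by blast
  let ?K = "D \<restriction> S"
  have K: "subgraph ?K D"
    using S by (intro induced_imp_subgraph induced_induce)
  then have wf: "wf_digraph ?K" by (simp add: subgraph_def)
  have "Digraph_Component.connected ?K"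
    unfolding connected_iff_cut[OF wf]
  proof (intro conjI allI impI)
    fix W assume W: "W \<noteq> {}" "W \<subset> verts ?K"
    show "\<exists>a\<in>arcs ?K. tail ?K a \<in> W \<longleftrightarrow> head ?K a \<notin> W"
    proof (rule ccontr)
      assume "\<not> ?thesis"
      \<comment> \<open>Whichever of \<open>W\<close> and \<open>S - W\<close> contains
        \<open>u\<close> contradicts the minimality of \<open>S\<close>.\<close>
      then have st: "stable W" "stable (S - W)"
        using W S(3) unfolding stable_def by auto
      show False
        using S_least[OF _ _ st(1)] S_least[OF _ _ st(2)] W S by auto
    qed
  qed (use S in auto)
  \<comment> \<open>Maximality: in a connected subgraph with further vertices, some arc of
    \<open>D\<close> would have to cross \<open>S\<close>.\<close>
  moreover have "H' = ?K" if H': "subgraph ?K H'" "subgraph H' D" "Digraph_Component.connected H'" for H'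
  proof -
    have wf': "wf_digraph H'" and th: "tail H' = tail D" "head H' = head D"
      and sub: "arcs H' \<subseteq> arcs D" "S \<subseteq> verts H'" "arcs ?K \<subseteq> arcs H'"
      using H' by (auto simp: subgraph_def compatible_def)
    have "S = verts H'"
    proof (rule ccontr)
      assume "S \<noteq> verts H'"
      then have "S \<subset> verts H'" "S \<noteq> {}" using sub S by auto
      then have "\<exists>a\<in>arcs H'. tail H' a \<in> S \<longleftrightarrow> head H' a \<notin> S"
        using H'(3)[unfolded connected_iff_cut[OF wf']] by (elim conjE allE[of _ S]) simp
      then obtain a where "a \<in> arcs H'" "tail H' a \<in> S \<longleftrightarrow> head H' a \<notin> S"
        by (elim bexE)
      then show False
        using S(3) sub th unfolding stable_def by auto
    qed
    moreover have "arcs H' = arcs ?K"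
      using sub th wf' calculation by (auto simp: wf_digraph_def)
    ultimately show ?thesis
      using th by (cases H') (auto simp: induce_subgraph_def)
  qed
  ultimately have "max_subgraph Digraph_Component.connected ?K"
    using K unfolding max_subgraph_def by blast
  with that S show thesis by simp
qed

text \<open>For a flow this is the complete sign pattern: by antisymmetry \<open>c $ a\<close> is
  negative iff the reverse of \<open>a\<close> belongs to the set, and zero iff neither orientation
  does.\<close>

definition pos_arcs :: "real ^ 'e \<Rightarrow> 'e set" where
  "pos_arcs c = {a. 0 < c $ a}"

text \<open>Adjoining \<open>a\<close> and its end points to \<open>K\<close> preserves
  connectedness, so maximality forces \<open>a\<close> to be there already.\<close>

lemma max_connected_subgraph_arc:
  assumes "wf_digraph D" and K: "pre_digraph.max_subgraph D Digraph_Component.connected K"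
    and a: "a \<in> arcs D" "tail D a \<in> verts K \<or> head D a \<in> verts K"
  shows "a \<in> arcs K"
proof -
  interpret wf_digraph D by fact
  have K': "subgraph K D" "Digraph_Component.connected K"
    and max: "\<And>H'. subgraph K H' \<Longrightarrow> subgraph H' D \<Longrightarrow> Digraph_Component.connected H' \<Longrightarrow> H' = K"
    using K unfolding max_subgraph_def by auto
  interpret K: wf_digraph K using K'(1) by (simp add: subgraph_def)
  have th: "tail K = tail D" "head K = head D" and sub: "arcs K \<subseteq> arcs D" "verts K \<subseteq> verts D"
    using K'(1) by (auto simp: subgraph_def compatible_def)
  define H' where "H' = \<lparr>verts = verts K \<union> {tail D a, head D a}, arcs = insert a (arcs K),
    tail = tail D, head = head D\<rparr>"
  have wf: "wf_digraph H'"
    using th K.wellformed by (auto simp: H'_def wf_digraph_def)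
  have "Digraph_Component.connected H'"
    unfolding connected_iff_cut[OF wf]
  proof (intro conjI allI impI)
    fix W assume W: "W \<noteq> {}" "W \<subset> verts H'"
    show "\<exists>b\<in>arcs H'. tail H' b \<in> W \<longleftrightarrow> head H' b \<notin> W"
    proof (cases "W \<inter> verts K \<noteq> {} \<and> W \<inter> verts K \<subset> verts K")
      case True
      then have "\<exists>b\<in>arcs K. tail K b \<in> W \<inter> verts K \<longleftrightarrow> head K b \<notin> W \<inter> verts K"
        using K'(2)[unfolded connected_iff_cut[OF K.wf_digraph_axioms]]
        by (elim conjE allE[of _ "W \<inter> verts K"]) simp
      then show ?thesis
        using K.wellformed th by (auto simp: H'_def)
    next
      case False
      then have "W \<inter> verts K = {} \<or> verts K \<subseteq> W" by blast
      \<comment> \<open>Here \<open>W\<close> either consists of the one end point of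
        \<open>a\<close> outside \<open>K\<close>, or omits exactly that vertex.\<close>
      then have "tail D a \<in> W \<longleftrightarrow> head D a \<notin> W"
        using W a(2) unfolding H'_def by auto
      then show ?thesis by (simp add: H'_def)
    qed
  qed (simp add: H'_def)
  moreover have "subgraph K H'" "subgraph H' D"
    using wf K'(1) a(1) sub th by (auto simp: subgraph_def compatible_def H'_def)
  ultimately have "H' = K" by (intro max)
  then show ?thesis by (metis H'_def insertI1 pre_digraph.select_convs(2))
qed

section \<open>Flows and totally cyclic orientations\<close>

locale finite_bidirected_graph = fin_digraph G + bidirected_digraph G \<iota>
  for G :: "('v, 'e::finite) pre_digraph" and \<iota>
begin

abbreviation "H \<equiv> H1 G \<iota> UNIV"

section \<open>The vector space of flows\<close>

lemma boundary_add: "boundary G (c + d) v = boundary G c v + boundary G d v"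
  by (simp add: boundary_def distrib_right sum.distrib)

lemma boundary_scaleR: "boundary G (r *\<^sub>R c) v = r * boundary G c v"
  by (simp add: boundary_def sum_distrib_left mult_ac)

lemma boundary_zero: "boundary G 0 v = 0"
  by (simp add: boundary_def)

lemma boundary_sum: "boundary G (sum f I) v = (\<Sum>i\<in>I. boundary G (f i) v)"
  by (induction I rule: infinite_finite_induct) (simp_all add: boundary_add boundary_zero)

lemma chain_reverse: "c \<in> chains G \<iota> A \<Longrightarrow> c $ \<iota> a = - c $ a"
  using arev_dom[of a] by (cases "a \<in> arcs G") (auto simp: chains_def)

lemma subspace_chains: "subspace (chains G \<iota> UNIV)"
  by (auto simp: subspace_def chains_def)

lemma subspace_H: "subspace H"
  using subspace_chains
  by (auto simp: subspace_def H1_def boundary_add boundary_scaleR boundary_zero)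

lemma H1_subset: "H1 G \<iota> A \<subseteq> H"
  by (auto simp: H1_def chains_def)

lemma H_in_chains: "c \<in> H \<Longrightarrow> c \<in> chains G \<iota> UNIV"
  by (simp add: H1_def)

lemma H_reverse: "c \<in> H \<Longrightarrow> c $ \<iota> a = - c $ a"
  using chain_reverse H_in_chains by blast

lemma chain_support: "c \<in> chains G \<iota> A \<Longrightarrow> c $ a \<noteq> 0 \<Longrightarrow> a \<in> arcs G"
  by (auto simp: chains_def)

lemma dart_chain: "a \<in> arcs G \<Longrightarrow> dart \<iota> a \<in> chains G \<iota> UNIV"
  using dart_in_chains[OF bidirected_digraph, of a] by (auto simp: chains_def)

lemma boundary_dart': "a \<in> arcs G \<Longrightarrow>
    boundary G (dart \<iota> a) v = of_bool (head G a = v) - of_bool (tail G a = v)"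
  by (rule boundary_dart[OF bidirected_digraph])

text \<open>Sum the vanishing boundaries over \<open>W\<close> and exchange the sums: only arcs
  crossing the cut contribute.\<close>

lemma cut_flow_zero:
  assumes "c \<in> H" "W \<subseteq> verts G"
  shows "(\<Sum>a\<in>arcs G. c $ a * (of_bool (head G a \<in> W) - of_bool (tail G a \<in> W))) = 0"
proof -
  have fin: "finite W" using assms(2) finite_verts by (rule finite_subset)
  have "0 = (\<Sum>v\<in>W. 2 * boundary G c v)"
    by (intro sum.neutral[symmetric] ballI) (use assms in \<open>auto simp: H1_def\<close>)
  also have "\<dots> = (\<Sum>v\<in>W. \<Sum>a\<in>arcs G. c $ a * (of_bool (head G a = v) - of_bool (tail G a = v)))"
    by (simp add: boundary_def)
  also have "\<dots> = (\<Sum>a\<in>arcs G. c $ a * (\<Sum>v\<in>W. of_bool (head G a = v) - of_bool (tail G a = v)))"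
    by (subst sum.swap) (simp add: sum_distrib_left)
  also have "\<dots> = (\<Sum>a\<in>arcs G. c $ a * (of_bool (head G a \<in> W) - of_bool (tail G a \<in> W)))"
    using fin by (simp add: sum_subtractf of_bool_def)
  finally show ?thesis by simp
qed

text \<open>If no positive arc enters \<open>W\<close>, all terms of the cut sum have the same sign;
  as the sum is zero, each term vanishes.\<close>

lemma one_way_cut_flow_zero:
  assumes c: "c \<in> H" "W \<subseteq> verts G"
    and out: "\<And>a. a \<in> pos_arcs c \<Longrightarrow> head G a \<in> W \<Longrightarrow> tail G a \<in> W"
    and a: "c $ a \<noteq> 0"
  shows "tail G a \<in> W \<longleftrightarrow> head G a \<in> W"
proof -
  let ?t = "\<lambda>a. - (c $ a * (of_bool (head G a \<in> W) - of_bool (tail G a \<in> W)))"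
  have nonneg: "?t b \<ge> 0" if b: "b \<in> arcs G" for b
  proof -
    have "head G b \<in> W \<Longrightarrow> tail G b \<notin> W \<Longrightarrow> c $ b \<le> 0"
      using out[of b] by (auto simp: pos_arcs_def not_less[symmetric])
    \<comment> \<open>A negative arc leaving \<open>W\<close> would be the reverse of a positive arc
      entering it.\<close>
    moreover have "tail G b \<in> W \<Longrightarrow> head G b \<notin> W \<Longrightarrow> 0 \<le> c $ b"
      using out[of "\<iota> b"] b H_reverse[OF c(1), of b] by (auto simp: pos_arcs_def not_less[symmetric])
    ultimately show ?thesis by (cases "head G b \<in> W"; cases "tail G b \<in> W") simp_all
  qed
  have "a \<in> arcs G" by (rule chain_support[OF H_in_chains[OF c(1)] a])
  moreover have "sum ?t (arcs G) = 0"
    using cut_flow_zero[OF c] by (simp add: sum_negf)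
  ultimately have "?t a = 0"
    using nonneg sum_nonneg_eq_0_iff[of "arcs G" ?t] by simp
  then show ?thesis using a by (auto split: if_splits simp: of_bool_def)
qed

section \<open>Orientations after deletion of edges, and flows with that sign pattern\<close>

lemma wf_delete_edges: "wf_digraph (delete_edges G T)"
  using wellformed by (auto simp: wf_digraph_def delete_edges_def)

lemma delete_edges_simps [simp]:
  "verts (delete_edges G T) = verts G" "tail (delete_edges G T) = tail G"
  "head (delete_edges G T) = head G" "arcs (delete_edges G T) = arcs G - \<Union>T"
  by (simp_all add: delete_edges_def)

lemma arcs_delete_edges:
  assumes "T \<subseteq> edges G \<iota>"
  shows "a \<in> arcs G - \<Union>T \<longleftrightarrow> {a, \<iota> a} \<in> edges G \<iota> - T"
proof -
  have "a \<in> arcs G" if "{a, \<iota> a} \<in> edges G \<iota>"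
    using that by (auto simp: edges_def doubleton_eq_iff)
  moreover have "{a, \<iota> a} \<in> T" if "a \<in> \<Union>T"
    using that assms by (auto simp: edges_def insert_commute)
  ultimately show ?thesis by (auto simp: edges_def)
qed

lemma edge_eq: "x \<in> edges G \<iota> \<Longrightarrow> a \<in> x \<Longrightarrow> x = {a, \<iota> a}"
  by (auto simp: edges_def)

lemma edge_subset_arcs: "x \<in> edges G \<iota> \<Longrightarrow> x \<subseteq> arcs G"
  by (auto simp: edges_def)

lemma orientation_in_edge:
  assumes "T \<subseteq> edges G \<iota>" "\<phi> \<in> orientations (delete_edges G T) \<iota>" "x \<in> edges G \<iota> - T"
  shows "\<phi> x \<in> x"
  using assms by (auto simp: orientations_def edges_delete_edges)

lemma oriented_arc_edge:
  assumes "T \<subseteq> edges G \<iota>" "\<phi> \<in> orientations (delete_edges G T) \<iota>"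
    and "a \<in> \<phi> ` (edges G \<iota> - T)"
  shows "{a, \<iota> a} \<in> edges G \<iota> - T" "\<phi> {a, \<iota> a} = a" "a \<in> arcs G - \<Union>T"
proof -
  obtain x where x: "x \<in> edges G \<iota> - T" "a = \<phi> x" using assms(3) by blast
  then have "a \<in> x" using orientation_in_edge[OF assms(1,2)] by simp
  then have "x = {a, \<iota> a}" using x edge_eq by blast
  then show "{a, \<iota> a} \<in> edges G \<iota> - T" "\<phi> {a, \<iota> a} = a" using x by auto
  then show "a \<in> arcs G - \<Union>T" using arcs_delete_edges[OF assms(1)] by simp
qed

lemma oriented_arc_reverse:
  assumes "T \<subseteq> edges G \<iota>" "\<phi> \<in> orientations (delete_edges G T) \<iota>"
    and "a \<in> \<phi> ` (edges G \<iota> - T)"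
  shows "\<iota> a \<notin> \<phi> ` (edges G \<iota> - T)"
proof
  assume "\<iota> a \<in> \<phi> ` (edges G \<iota> - T)"
  then have "\<phi> {a, \<iota> a} = \<iota> a"
    using oriented_arc_edge(2)[OF assms(1,2), of "\<iota> a"] by (simp add: insert_commute)
  then show False
    using oriented_arc_edge[OF assms] arev_neq[of a] by auto
qed

text \<open>A cut of a component with all its edges oriented outward would carry no flow, whereas
  \<open>c\<close> is nonzero on every remaining edge.\<close>

lemma totally_cyclic_if_flow:
  assumes T: "T \<subseteq> edges G \<iota>" and \<phi>: "\<phi> \<in> orientations (delete_edges G T) \<iota>"
    and c: "c \<in> H" "pos_arcs c = \<phi> ` (edges G \<iota> - T)"
  shows "totally_cyclic (delete_edges G T) \<iota> \<phi>"
  unfolding totally_cyclic_def totally_cyclic_connected_def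
proof (intro allI impI notI, elim exE conjE)
  let ?D = "delete_edges G T"
  fix K W
  assume K: "pre_digraph.max_subgraph ?D Digraph_Component.connected K"
    and W: "W \<noteq> {}" "W \<subset> verts K"
    and out: "\<forall>x\<in>edges K \<iota>. edge_between K x W (verts K - W) \<longrightarrow>
      tail K (restrict \<phi> (edges K \<iota>) x) \<in> W \<and> head K (restrict \<phi> (edges K \<iota>) x) \<in> verts K - W"
  have sub: "subgraph K ?D" and conn: "Digraph_Component.connected K"
    using K by (auto simp: pre_digraph.max_subgraph_def)
  interpret K: wf_digraph K using sub by (simp add: subgraph_def)
  have th: "tail K = tail G" "head K = head G" and sub: "arcs K \<subseteq> arcs G - \<Union>T" "verts K \<subseteq> verts G"
    using sub by (auto simp: subgraph_def compatible_def)
  have "tail G a \<in> W" if a: "a \<in> pos_arcs c" "head G a \<in> W" for a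
  proof (rule ccontr)
    assume t: "tail G a \<notin> W"
    note o = oriented_arc_edge[OF T \<phi> a(1)[unfolded c(2)]]
    have aK: "a \<in> arcs K"
      using max_connected_subgraph_arc[OF wf_delete_edges K, of a] o(3) a(2) W by auto
    then have "{a, \<iota> a} \<in> edges K \<iota>" by (auto simp: edges_def)
    moreover have "edge_between K {a, \<iota> a} W (verts K - W)"
      using a(2) t o(3) K.wellformed[OF aK] th by (auto simp: edge_between_def)
    ultimately show False
      using out t o(2) th by auto
  qed
  then have noncross: "tail G a \<in> W \<longleftrightarrow> head G a \<in> W" if "c $ a \<noteq> 0" for a
    using one_way_cut_flow_zero[OF c(1), of W a] that W sub by blast
  \<comment> \<open>Connectedness of \<open>K\<close> supplies an edge across the cut, on which
    \<open>c\<close> would have to vanish.\<close>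
  have "\<exists>a\<in>arcs K. tail K a \<in> W \<longleftrightarrow> head K a \<notin> W"
    using conn[unfolded connected_iff_cut[OF K.wf_digraph_axioms]] W
    by (elim conjE allE[of _ W]) simp
  then obtain a where a: "a \<in> arcs K" "tail K a \<in> W \<longleftrightarrow> head K a \<notin> W" by (elim bexE)
  then have e: "{a, \<iota> a} \<in> edges G \<iota> - T" using arcs_delete_edges[OF T] sub by blast
  then have "\<phi> {a, \<iota> a} \<in> {a, \<iota> a}" "\<phi> {a, \<iota> a} \<in> pos_arcs c"
    using orientation_in_edge[OF T \<phi> e] c(2) by auto
  then have "c $ a \<noteq> 0"
    using H_reverse[OF c(1), of a] by (auto simp: pos_arcs_def)
  then show False using noncross a(2) th by auto
qed

lemma dart_pos: "0 < dart \<iota> b $ e \<Longrightarrow> e = b"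
  by (auto simp: dart_def axis_def split: if_splits)

lemma dart_self: "b \<in> arcs G \<Longrightarrow> dart \<iota> b $ b = 1"
  using arev_neq[of b] by (auto simp: dart_def axis_def)

text \<open>Positivity is obtained at the single arc \<open>a\<close> only; summing over all
  oriented arcs in \<open>flow_if_totally_cyclic\<close> then covers the whole orientation.\<close>

lemma ex_flow_through_arc:
  assumes T: "T \<subseteq> edges G \<iota>" and \<phi>: "\<phi> \<in> orientations (delete_edges G T) \<iota>"
    and tc: "totally_cyclic (delete_edges G T) \<iota> \<phi>"
    and a: "a \<in> \<phi> ` (edges G \<iota> - T)"
  shows "\<exists>c\<in>H. pos_arcs c \<subseteq> \<phi> ` (edges G \<iota> - T) \<and> 0 < c $ a"
proof -
  let ?O = "\<phi> ` (edges G \<iota> - T)" and ?D = "delete_edges G T"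
  txt \<open>The vertices reachable from \<open>head G a\<close> along the orientation, witnessed by a unit chain.\<close>
  define R where "R = {v \<in> verts G. \<exists>c\<in>chains G \<iota> UNIV. pos_arcs c \<subseteq> ?O \<and>
    (\<forall>w. boundary G c w = of_bool (v = w) - of_bool (head G a = w))}"
  note oa = oriented_arc_edge[OF T \<phi> a]
  have O_arcs: "b \<in> arcs G - \<Union>T" if "b \<in> ?O" for b
    using oriented_arc_edge[OF T \<phi> that] by simp
  have ext: "c + dart \<iota> b \<in> chains G \<iota> UNIV" "pos_arcs (c + dart \<iota> b) \<subseteq> ?O"
    if "c \<in> chains G \<iota> UNIV" "pos_arcs c \<subseteq> ?O" "b \<in> ?O" for c b
  proof -
    show "c + dart \<iota> b \<in> chains G \<iota> UNIV"
      using that O_arcs subspace_chains dart_chain by (auto intro: subspace_add)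
    have "e \<in> ?O" if e: "0 < c $ e + dart \<iota> b $ e" for e
    proof -
      have "0 < c $ e \<or> 0 < dart \<iota> b $ e" using e by linarith
      then show ?thesis
        using \<open>pos_arcs c \<subseteq> ?O\<close> \<open>b \<in> ?O\<close> dart_pos by (auto simp: pos_arcs_def)
    qed
    then show "pos_arcs (c + dart \<iota> b) \<subseteq> ?O" by (auto simp: pos_arcs_def)
  qed
  have head_R: "head G a \<in> R"
    using oa(3) subspace_0[OF subspace_chains]
    by (auto simp: R_def pos_arcs_def boundary_zero intro!: bexI[of _ 0])
  have step: "head G b \<in> R" if b: "b \<in> ?O" "tail G b \<in> R" for b
  proof -
    obtain c where c: "c \<in> chains G \<iota> UNIV" "pos_arcs c \<subseteq> ?O"
      "\<forall>w. boundary G c w = of_bool (tail G b = w) - of_bool (head G a = w)"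
      using b(2) unfolding R_def by blast
    have "boundary G (c + dart \<iota> b) w = of_bool (head G b = w) - of_bool (head G a = w)" for w
      using c(3) O_arcs[OF b(1)] by (simp add: boundary_add boundary_dart')
    then show ?thesis
      using ext[OF c(1,2) b(1)] O_arcs[OF b(1)] unfolding R_def
      by (intro CollectI conjI bexI[of _ "c + dart \<iota> b"] allI) simp_all
  qed
  have "tail G a \<in> R"
  proof (rule ccontr)
    assume t: "tail G a \<notin> R"
    have "\<iota> b \<in> arcs ?D" if "b \<in> arcs ?D" for b
      using that arcs_delete_edges[OF T, of b] arcs_delete_edges[OF T, of "\<iota> b"]
      by (simp add: insert_commute)
    then obtain K where K: "pre_digraph.max_subgraph ?D Digraph_Component.connected K"
      and tK: "tail G a \<in> verts K"
      using oa(3) by (elim ex_max_connected_subgraph[OF wf_delete_edges, of T \<iota> "tail G a", rotated -1]) auto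
    have sub: "subgraph K ?D" using K by (auto simp: pre_digraph.max_subgraph_def)
    interpret K: wf_digraph K using sub by (simp add: subgraph_def)
    have th: "tail K = tail G" "head K = head G"
      and sub: "arcs K \<subseteq> arcs G - \<Union>T" "verts K \<subseteq> verts G"
      using sub by (auto simp: subgraph_def compatible_def)
    have aK: "a \<in> arcs K"
      using max_connected_subgraph_arc[OF wf_delete_edges K, of a] oa(3) tK by auto
    \<comment> \<open>Arcs of \<open>?O\<close> never lead out of \<open>R\<close>, so every edge
      between \<open>?W\<close> and the rest of \<open>K\<close> is oriented out of
      \<open>?W\<close>. Total cyclicity forbids this.\<close>
    let ?W = "verts K - R"
    have "head G a \<in> verts K" using K.wellformed[OF aK] th by simp
    then have W: "?W \<noteq> {}" "?W \<subset> verts K" using t tK head_R by auto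
    have "totally_cyclic_connected K \<iota> (restrict \<phi> (edges K \<iota>))"
      using tc K unfolding totally_cyclic_def by blast
    then obtain x where x: "x \<in> edges K \<iota>" "edge_between K x ?W (verts K - ?W)"
      "\<not> (tail K (\<phi> x) \<in> ?W \<and> head K (\<phi> x) \<in> verts K - ?W)"
      using W unfolding totally_cyclic_connected_def by (metis (no_types, lifting) restrict_apply')
    obtain e where "e \<in> arcs K" "x = {e, \<iota> e}" using x(1) by (auto simp: edges_def)
    then have xG: "x \<in> edges G \<iota> - T" using arcs_delete_edges[OF T] sub by blast
    obtain b where b: "b \<in> x" "tail G b \<in> ?W" "head G b \<in> verts K - ?W"
      using x(2) th by (auto simp: edge_between_def)
    have b': "x = {b, \<iota> b}" "b \<in> arcs G" using b edge_eq edge_subset_arcs xG by blast+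
    have "\<phi> x \<noteq> b" using b x(3) th by auto
    then have "\<phi> x = \<iota> b" using orientation_in_edge[OF T \<phi> xG] b' by auto
    then have "\<iota> b \<in> ?O" using xG by force
    then show False using step[of "\<iota> b"] b b'(2) by auto
  qed
  then obtain c where c: "c \<in> chains G \<iota> UNIV" "pos_arcs c \<subseteq> ?O"
    "\<forall>w. boundary G c w = of_bool (tail G a = w) - of_bool (head G a = w)"
    unfolding R_def by blast
  \<comment> \<open>Equivalently \<open>c $ a\<close> is nonnegative, so the unit along
    \<open>a\<close> that closes the chain to a flow cannot be cancelled there.\<close>
  have "c $ \<iota> a \<le> 0"
    using oriented_arc_reverse[OF T \<phi> a] c(2) by (force simp: pos_arcs_def)
  then have "0 < (c + dart \<iota> a) $ a"
    using chain_reverse[OF c(1), of a] dart_self oa(3) by simp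
  moreover have "c + dart \<iota> a \<in> H"
    using ext[OF c(1,2) a] c(3) oa(3) by (simp add: H1_def boundary_add boundary_dart')
  ultimately show ?thesis using ext[OF c(1,2) a] by blast
qed

text \<open>The summands \<open>f a\<close> are nonnegative on \<open>?O\<close> and nonpositive
  elsewhere, so nothing cancels in their sum.\<close>

lemma flow_if_totally_cyclic:
  assumes T: "T \<subseteq> edges G \<iota>" and \<phi>: "\<phi> \<in> orientations (delete_edges G T) \<iota>"
    and tc: "totally_cyclic (delete_edges G T) \<iota> \<phi>"
  shows "\<phi> ` (edges G \<iota> - T) \<in> pos_arcs ` H"
proof -
  let ?O = "\<phi> ` (edges G \<iota> - T)"
  have "\<exists>f. \<forall>a\<in>?O. f a \<in> H \<and> pos_arcs (f a) \<subseteq> ?O \<and> 0 < f a $ a"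
    using ex_flow_through_arc[OF assms] by (intro bchoice) blast
  then obtain f where f: "\<And>a. a \<in> ?O \<Longrightarrow> f a \<in> H" "\<And>a. a \<in> ?O \<Longrightarrow> pos_arcs (f a) \<subseteq> ?O"
    "\<And>a. a \<in> ?O \<Longrightarrow> 0 < f a $ a" by blast
  let ?c = "sum f ?O"
  have nonpos: "f a $ e \<le> 0" if "a \<in> ?O" "e \<notin> ?O" for a e
    using f(2)[OF that(1)] that(2) by (force simp: pos_arcs_def)
  have nonneg: "f a $ e \<ge> 0" if "a \<in> ?O" "e \<in> ?O" for a e
    using nonpos[OF that(1) oriented_arc_reverse[OF T \<phi> that(2)]] H_reverse[OF f(1)[OF that(1)]]
    by simp
  have "e \<in> pos_arcs ?c \<longleftrightarrow> e \<in> ?O" for e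
  proof (cases "e \<in> ?O")
    case True
    then have "0 < (\<Sum>a\<in>?O. f a $ e)"
      using nonneg f(3) by (intro sum_pos2[of _ e]) auto
    then show ?thesis using True by (simp add: pos_arcs_def)
  next
    case False
    then have "(\<Sum>a\<in>?O. f a $ e) \<le> 0"
      using nonpos by (intro sum_nonpos) blast
    then show ?thesis using False by (simp add: pos_arcs_def)
  qed
  then have "pos_arcs ?c = ?O" by blast
  moreover have "?c \<in> H" using f(1) subspace_H by (intro subspace_sum) auto
  ultimately show ?thesis by (metis imageI)
qed


section \<open>The poset of totally cyclic orientations as a poset of sign patterns\<close>

text \<open>The set of chosen arcs contains at most one orientation of each edge, so it determines
  both which edges survive and how they are oriented.\<close>

lemma OP_le_iff:
  assumes p: "(T', \<phi>') \<in> OP G \<iota>" and q: "(T, \<phi>) \<in> OP G \<iota>"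
  shows "OP_le G \<iota> (T', \<phi>') (T, \<phi>) \<longleftrightarrow> \<phi>' ` (edges G \<iota> - T') \<subseteq> \<phi> ` (edges G \<iota> - T)"
proof -
  have T': "T' \<subseteq> edges G \<iota>" and o': "\<phi>' \<in> orientations (delete_edges G T') \<iota>"
    and T: "T \<subseteq> edges G \<iota>" and oo: "\<phi> \<in> orientations (delete_edges G T) \<iota>"
    using p q by (auto simp: OP_def)
  have le: "OP_le G \<iota> (T', \<phi>') (T, \<phi>) \<longleftrightarrow> T \<subseteq> T' \<and> \<phi>' = restrict \<phi> (edges G \<iota> - T')"
    unfolding OP_le_def by (simp add: edges_delete_edges[OF T'])
  show ?thesis
    unfolding le
  proof
    assume "T \<subseteq> T' \<and> \<phi>' = restrict \<phi> (edges G \<iota> - T')"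
    then show "\<phi>' ` (edges G \<iota> - T') \<subseteq> \<phi> ` (edges G \<iota> - T)" by auto
  next
    assume sub: "\<phi>' ` (edges G \<iota> - T') \<subseteq> \<phi> ` (edges G \<iota> - T)"
    have agree: "x \<notin> T \<and> \<phi>' x = \<phi> x" if x: "x \<in> edges G \<iota> - T'" for x
    proof -
      have a: "\<phi>' x \<in> x" by (rule orientation_in_edge[OF T' o' x])
      have "\<phi>' x \<in> \<phi> ` (edges G \<iota> - T)" using sub x by blast
      from oriented_arc_edge[OF T oo this] show ?thesis
        using edge_eq[of x "\<phi>' x"] a x by auto
    qed
    have "\<phi>' = restrict \<phi> (edges G \<iota> - T')"
      using o' agree unfolding orientations_def edges_delete_edges[OF T']
      by (intro ext) (auto simp: restrict_def PiE_def extensional_def)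
    then show "T \<subseteq> T' \<and> \<phi>' = restrict \<phi> (edges G \<iota> - T')"
      using agree T by blast
  qed
qed

text \<open>Delete the edges on which \<open>c\<close> vanishes and orient each other edge along the
  flow; antisymmetry makes that choice unique.\<close>

lemma OP_surj:
  assumes c: "c \<in> H"
  shows "\<exists>(T, \<phi>)\<in>OP G \<iota>. \<phi> ` (edges G \<iota> - T) = pos_arcs c"
proof -
  define T where "T = {x \<in> edges G \<iota>. x \<inter> pos_arcs c = {}}"
  define \<phi> where "\<phi> = restrict (\<lambda>x. THE a. a \<in> x \<and> a \<in> pos_arcs c) (edges G \<iota> - T)"
  have T: "T \<subseteq> edges G \<iota>" by (auto simp: T_def)
  have \<phi>_eq: "\<phi> x = a" if "x \<in> edges G \<iota> - T" "a \<in> x" "a \<in> pos_arcs c" for x a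
  proof -
    have "x = {a, \<iota> a}" using that edge_eq by blast
    moreover have "\<iota> a \<notin> pos_arcs c"
      using that(3) H_reverse[OF c, of a] by (simp add: pos_arcs_def)
    ultimately have "(THE a. a \<in> x \<and> a \<in> pos_arcs c) = a"
      using that by (intro the_equality) auto
    then show ?thesis using that(1) by (simp add: \<phi>_def)
  qed
  have ex: "\<exists>a\<in>x. a \<in> pos_arcs c" if "x \<in> edges G \<iota> - T" for x
    using that by (auto simp: T_def)
  have o: "\<phi> \<in> orientations (delete_edges G T) \<iota>"
    unfolding orientations_def edges_delete_edges[OF T]
  proof (rule PiE_I)
    fix x assume x: "x \<in> edges G \<iota> - T"
    then show "\<phi> x \<in> x" using ex[OF x] \<phi>_eq[OF x] by auto
  qed (auto simp: \<phi>_def)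
  have im: "\<phi> ` (edges G \<iota> - T) = pos_arcs c"
  proof (intro equalityI subsetI)
    fix a assume "a \<in> \<phi> ` (edges G \<iota> - T)"
    then show "a \<in> pos_arcs c" using ex \<phi>_eq by fastforce
  next
    fix a assume a: "a \<in> pos_arcs c"
    then have "a \<in> arcs G" using chain_support[OF H_in_chains[OF c]] by (simp add: pos_arcs_def)
    then have x: "{a, \<iota> a} \<in> edges G \<iota> - T" using a by (auto simp: T_def edges_def)
    then have "\<phi> {a, \<iota> a} = a" using \<phi>_eq a by blast
    then show "a \<in> \<phi> ` (edges G \<iota> - T)" using x by (metis imageI)
  qed
  have "(T, \<phi>) \<in> OP G \<iota>"
    using T o totally_cyclic_if_flow[OF T o c im[symmetric]] by (simp add: OP_def)
  then show ?thesis using im by blast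
qed

lemma OP_isomorphic: "poset_isomorphic (OP G \<iota>) (OP_le G \<iota>) (pos_arcs ` H) (\<subseteq>)"
proof (rule poset_isomorphicI[where f = "\<lambda>(T, \<phi>). \<phi> ` (edges G \<iota> - T)"])
  show "(\<lambda>(T, \<phi>). \<phi> ` (edges G \<iota> - T)) ` OP G \<iota> = pos_arcs ` H"
  proof (intro equalityI subsetI)
    fix P assume "P \<in> (\<lambda>(T, \<phi>). \<phi> ` (edges G \<iota> - T)) ` OP G \<iota>"
    then obtain T \<phi> where "(T, \<phi>) \<in> OP G \<iota>" "P = \<phi> ` (edges G \<iota> - T)" by auto
    then show "P \<in> pos_arcs ` H"
      using flow_if_totally_cyclic[of T \<phi>] by (simp add: OP_def)
  next
    fix P assume "P \<in> pos_arcs ` H"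
    then obtain c where "c \<in> H" "P = pos_arcs c" by blast
    then show "P \<in> (\<lambda>(T, \<phi>). \<phi> ` (edges G \<iota> - T)) ` OP G \<iota>"
      using OP_surj[of c] by (auto simp: image_iff)
  qed
  show "x = y" if "x \<in> OP G \<iota>" "y \<in> OP G \<iota>" "OP_le G \<iota> x y" "OP_le G \<iota> y x" for x y
    using OP_le_partial_order[of G \<iota>] that
    unfolding partial_order_on_def antisym_def
    by (elim conjE allE[of _ x] allE[of _ y]) simp
  show "OP_le G \<iota> x y \<longleftrightarrow>
      (case x of (T, \<phi>) \<Rightarrow> \<phi> ` (edges G \<iota> - T)) \<subseteq>
      (case y of (T, \<phi>) \<Rightarrow> \<phi> ` (edges G \<iota> - T))"
    if "x \<in> OP G \<iota>" "y \<in> OP G \<iota>" for x y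
    using that OP_le_iff by (cases x; cases y) simp
qed simp

section \<open>Cycles in the support of a flow\<close>

text \<open>Supplies the cycles that are peeled off a flow in \<open>inner_le_l1_of_Vor\<close>. The
  restriction on the entries is what makes the squared norm of \<open>z\<close> equal to its
  \<open>l1\<close> norm.\<close>

lemma ex_cycle_within_support:
  assumes c: "c \<in> H" "c \<noteq> 0"
  shows "\<exists>z\<in>H1 G \<iota> \<int>. z \<noteq> 0 \<and> (\<forall>a. z $ a \<in> {-1, 0, 1}) \<and> pos_arcs z \<subseteq> pos_arcs c"
proof -
  define V where "V = tail G ` pos_arcs c"
  have pos_arc: "a \<in> arcs G" if "a \<in> pos_arcs c" for a
    using that chain_support[OF H_in_chains[OF c(1)]] by (simp add: pos_arcs_def)
  have "finite V" unfolding V_def by simp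
  have "V \<noteq> {}"
  proof -
    obtain a where "c $ a \<noteq> 0" using c(2) by (auto simp: vec_eq_iff)
    then have "a \<in> pos_arcs c \<or> \<iota> a \<in> pos_arcs c"
      using H_reverse[OF c(1), of a] by (auto simp: pos_arcs_def)
    then show ?thesis by (auto simp: V_def)
  qed
  \<comment> \<open>Conservation at a vertex: if no positive arc left \<open>head G a\<close>, the
    remaining vertices would form a cut that positive arcs only leave, so \<open>a\<close> could not
    cross it.\<close>
  have head_V: "head G a \<in> V" if a: "a \<in> pos_arcs c" for a
  proof (rule ccontr)
    assume n: "head G a \<notin> V"
    have "tail G a \<in> verts G - {head G a} \<longleftrightarrow> head G a \<in> verts G - {head G a}"
    proof (rule one_way_cut_flow_zero[OF c(1)])
      show "tail G b \<in> verts G - {head G a}" if "b \<in> pos_arcs c" for b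
      proof -
        have "tail G b \<in> V" using that by (simp add: V_def)
        then show ?thesis using n pos_arc[OF that] by auto
      qed
    qed (use a in \<open>auto simp: pos_arcs_def\<close>)
    then have "tail G a = head G a" using pos_arc[OF a] by simp
    moreover have "tail G a \<in> V" using a by (simp add: V_def)
    ultimately show False using n by simp
  qed
  have "\<forall>v\<in>V. \<exists>a. a \<in> pos_arcs c \<and> tail G a = v" by (auto simp: V_def)
  then obtain g where g: "\<And>v. v \<in> V \<Longrightarrow> g v \<in> pos_arcs c" "\<And>v. v \<in> V \<Longrightarrow> tail G (g v) = v"
    by metis
  define f where "f v = head G (g v)" for v
  txt \<open>Following from each vertex a fixed outgoing arc of the support permutes a minimal invariant
    set of vertices; the arcs used there make up a sum of disjoint cycles.\<close>
  define inv where "inv P \<longleftrightarrow> P \<noteq> {} \<and> P \<subseteq> V \<and> f ` P \<subseteq> P" for P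
  have "inv V" using \<open>V \<noteq> {}\<close> head_V g by (auto simp: f_def inv_def)
  then obtain P where P': "inv P" and min: "\<And>P'. inv P' \<Longrightarrow> card P \<le> card P'"
    using ex_has_least_nat[of inv V card] by blast
  then have P: "P \<noteq> {}" "P \<subseteq> V" "f ` P \<subseteq> P" by (simp_all add: inv_def)
  have "finite P" using P(2) \<open>finite V\<close> by (rule finite_subset)
  \<comment> \<open>The image of \<open>P\<close> is again invariant, so by minimality
    \<open>f\<close> is surjective on \<open>P\<close>, hence injective.\<close>
  have "card P \<le> card (f ` P)"
    by (rule min) (use P in \<open>auto simp: inv_def\<close>)
  then have fP: "f ` P = P" using P(3) \<open>finite P\<close> by (intro card_seteq)
  then have inj_f: "inj_on f P" using \<open>finite P\<close> by (simp add: eq_card_imp_inj_on)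
  define z where "z = (\<Sum>v\<in>P. dart \<iota> (g v))"
  have gP: "g v \<in> arcs G" "g v \<in> pos_arcs c" "tail G (g v) = v" if "v \<in> P" for v
    using that P g pos_arc by blast+
  have inj_g: "inj_on g P" using gP(3) by (metis inj_onI)
  have count: "(\<Sum>v\<in>P. of_bool (h v = y)) = (of_bool (y \<in> h ` P) :: real)"
    if "inj_on h P" for h :: "'v \<Rightarrow> 'x" and y
  proof -
    have "(\<Sum>v\<in>P. of_bool (h v = y)) = (\<Sum>w\<in>h ` P. of_bool (w = y) :: real)"
      using that by (simp add: sum.reindex)
    also have "\<dots> = of_bool (y \<in> h ` P)"
      using \<open>finite P\<close> by (simp add: of_bool_def)
    finally show ?thesis .
  qed
  \<comment> \<open>Distinct vertices select arcs with distinct tails, so each sum over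
    \<open>P\<close> is an indicator.\<close>
  have z_at: "z $ a = of_bool (a \<in> g ` P) - of_bool (\<iota> a \<in> g ` P)" for a
  proof -
    have "\<iota> (g v) = a \<longleftrightarrow> g v = \<iota> a" for v by (metis arev_arev)
    then have "z $ a = (\<Sum>v\<in>P. of_bool (g v = a)) - (\<Sum>v\<in>P. of_bool (g v = \<iota> a))"
      by (simp add: z_def dart_def axis_def sum_subtractf of_bool_def eq_commute)
    then show ?thesis by (simp add: count[OF inj_g])
  qed
  have z_chain: "z \<in> chains G \<iota> \<int>"
  proof -
    have "z \<in> chains G \<iota> UNIV"
      unfolding z_def using subspace_chains dart_chain gP by (intro subspace_sum) auto
    then show ?thesis by (auto simp: chains_def z_at)
  qed
  \<comment> \<open>The heads of the selected arcs are the \<open>f v\<close> and the tails are the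
    \<open>v\<close>; since \<open>f\<close> permutes \<open>P\<close>, they cancel.\<close>
  have "boundary G z w = 0" for w
  proof -
    have "boundary G z w = (\<Sum>v\<in>P. of_bool (f v = w)) - (\<Sum>v\<in>P. of_bool (v = w))"
      using gP by (simp add: z_def boundary_sum boundary_dart' sum_subtractf f_def)
    then show ?thesis using count[OF inj_f, of w] count[of "\<lambda>v. v" w] fP by simp
  qed
  then have "z \<in> H1 G \<iota> \<int>" using z_chain by (simp add: H1_def)
  moreover have "pos_arcs z \<subseteq> pos_arcs c"
    using gP by (auto simp: pos_arcs_def z_at of_bool_def split: if_splits)
  moreover have "z \<noteq> 0"
  proof -
    obtain v where v: "v \<in> P" using P by blast
    \<comment> \<open>Selected arcs are positive for \<open>c\<close>, so no selected arc is the
      reverse of another and \<open>z\<close> does not cancel.\<close>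
    have "\<iota> (g v) \<notin> pos_arcs c"
      using gP(2)[OF v] H_reverse[OF c(1), of "g v"] by (simp add: pos_arcs_def)
    then have "\<iota> (g v) \<notin> g ` P" using gP(2) by auto
    then have "z $ g v = 1" using v by (simp add: z_at)
    then show ?thesis by auto
  qed
  moreover have "\<forall>a. z $ a \<in> {-1, 0, 1}" by (simp add: z_at)
  ultimately show ?thesis by blast
qed

end

section \<open>The Voronoi polytope as a zonotope\<close>

text \<open>There is one coordinate per oriented edge and no antisymmetry is imposed; the later
  projection to \<open>H\<close> takes care of that.\<close>

definition cube :: "(real ^ 'e::finite) set" where
  "cube = {x. \<forall>a. \<bar>x $ a\<bar> \<le> 1/2}"

text \<open>For a flow each edge counts twice, which matches the plain inner product used below in
  place of \<open>form\<close>.\<close>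

definition l1 :: "real ^ 'e::finite \<Rightarrow> real" where
  "l1 c = (\<Sum>a\<in>UNIV. \<bar>c $ a\<bar>)"

text \<open>The barycentre of the face of the cube maximising \<open>c\<close>: coordinates where
  \<open>c\<close> vanishes become 0. Hence the sign pattern of \<open>c\<close> can be recovered
  from this point.\<close>

definition sign_vertex :: "real ^ 'e::finite \<Rightarrow> real ^ 'e" where
  "sign_vertex c = (\<chi> a. sgn (c $ a) / 2)"

lemma cube_eq_cbox: "cube = cbox (\<chi> a. - 1/2) (\<chi> a. 1/2)"
proof -
  have "\<bar>t\<bar> \<le> 1/2 \<longleftrightarrow> - 1/2 \<le> t \<and> t \<le> 1/2" for t :: real by auto
  then show ?thesis
    unfolding cube_def by (simp only: set_eq_iff mem_box_cart vec_lambda_beta mem_Collect_eq) simp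
qed

lemma sign_vertex_in_cube: "sign_vertex c \<in> cube"
  by (simp add: cube_def sign_vertex_def sgn_real_def)

text \<open>The support function of the cube. The bound holds in each coordinate, so equality of the
  sums is equality in every term.\<close>

lemma inner_cube_le:
  assumes "x \<in> cube"
  shows "c \<bullet> x \<le> l1 c / 2"
    and "c \<bullet> x = l1 c / 2 \<longleftrightarrow> (\<forall>a. c $ a * x $ a = \<bar>c $ a\<bar> / 2)"
proof -
  have nonneg: "0 \<le> \<bar>c $ a\<bar> / 2 - c $ a * x $ a" for a
  proof -
    have "c $ a * x $ a \<le> \<bar>c $ a\<bar> * \<bar>x $ a\<bar>" by (metis abs_ge_self abs_mult)
    also have "\<dots> \<le> \<bar>c $ a\<bar> * (1/2)"
      using assms by (intro mult_left_mono) (auto simp: cube_def)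
    finally show ?thesis by simp
  qed
  have diff: "l1 c / 2 - c \<bullet> x = (\<Sum>a\<in>UNIV. \<bar>c $ a\<bar> / 2 - c $ a * x $ a)"
    by (simp add: l1_def inner_vec_def sum_subtractf sum_divide_distrib)
  have "0 \<le> (\<Sum>a\<in>UNIV. \<bar>c $ a\<bar> / 2 - c $ a * x $ a)"
    using nonneg by (rule sum_nonneg)
  then show "c \<bullet> x \<le> l1 c / 2" using diff by linarith
  have "c \<bullet> x = l1 c / 2 \<longleftrightarrow> (\<Sum>a\<in>UNIV. \<bar>c $ a\<bar> / 2 - c $ a * x $ a) = 0"
    using diff by linarith
  also have "\<dots> \<longleftrightarrow> (\<forall>a. \<bar>c $ a\<bar> / 2 - c $ a * x $ a = 0)"
    using nonneg by (subst sum_nonneg_eq_0_iff) auto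
  also have "\<dots> \<longleftrightarrow> (\<forall>a. c $ a * x $ a = \<bar>c $ a\<bar> / 2)"
    by (intro iff_allI) linarith
  finally show "c \<bullet> x = l1 c / 2 \<longleftrightarrow> (\<forall>a. c $ a * x $ a = \<bar>c $ a\<bar> / 2)" .
qed

lemma inner_sign_vertex: "c \<bullet> sign_vertex c = l1 c / 2"
  unfolding inner_cube_le(2)[OF sign_vertex_in_cube]
  by (simp add: sign_vertex_def sgn_real_def)

context finite_bidirected_graph
begin

text \<open>The negative coordinates of a flow are the reverses of its positive ones, so positive
  arcs alone describe the maximising face.\<close>

lemma inner_cube_eq_iff:
  assumes "c \<in> H" "x \<in> cube"
  shows "c \<bullet> x = l1 c / 2 \<longleftrightarrow> (\<forall>a\<in>pos_arcs c. x $ a = 1/2 \<and> x $ \<iota> a = - 1/2)"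
  unfolding inner_cube_le(2)[OF assms(2)]
proof (intro iffI ballI allI)
  fix a assume all: "\<forall>a. c $ a * x $ a = \<bar>c $ a\<bar> / 2" and a: "a \<in> pos_arcs c"
  have "c $ a * x $ a = c $ a * (1/2)" "c $ a * x $ \<iota> a = c $ a * (- 1/2)"
    using all[rule_format, of a] all[rule_format, of "\<iota> a"] a H_reverse[OF assms(1), of a]
    by (simp_all add: pos_arcs_def)
  then show "x $ a = 1/2 \<and> x $ \<iota> a = - 1/2"
    using a unfolding mult_cancel_left by (simp add: pos_arcs_def)
next
  fix a assume all: "\<forall>a\<in>pos_arcs c. x $ a = 1/2 \<and> x $ \<iota> a = - 1/2"
  consider "c $ a = 0" | "a \<in> pos_arcs c" | "\<iota> a \<in> pos_arcs c" "c $ a < 0"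
    using H_reverse[OF assms(1), of a] by (force simp: pos_arcs_def)
  then show "c $ a * x $ a = \<bar>c $ a\<bar> / 2"
  proof cases
    case 2
    then show ?thesis using all by (simp add: pos_arcs_def)
  next
    case 3
    then have "x $ a = - 1/2" using all arev_arev[of a] by metis
    then show ?thesis using 3 by simp
  qed simp
qed

section \<open>Orthogonal projection to the flows\<close>

definition proj :: "real ^ 'e \<Rightarrow> real ^ 'e" where
  "proj x = (SOME y. y \<in> H \<and> (\<forall>w\<in>H. w \<bullet> (x - y) = 0))"

lemma proj: "proj x \<in> H" "w \<in> H \<Longrightarrow> w \<bullet> proj x = w \<bullet> x"
proof -
  obtain y z where yz: "y \<in> span H" "\<And>w. w \<in> span H \<Longrightarrow> orthogonal z w" "x = y + z"
    using orthogonal_subspace_decomp_exists[of H x] by metis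
  have sp: "span H = H" using subspace_H by (simp add: span_eq_iff)
  have "y \<in> H \<and> (\<forall>w\<in>H. w \<bullet> (x - y) = 0)"
    using yz unfolding sp by (auto simp: orthogonal_def inner_commute)
  then have "proj x \<in> H \<and> (\<forall>w\<in>H. w \<bullet> (x - proj x) = 0)"
    unfolding proj_def by (rule someI)
  then show "proj x \<in> H" "w \<in> H \<Longrightarrow> w \<bullet> proj x = w \<bullet> x"
    by (auto simp: inner_diff_right)
qed

lemma proj_unique:
  assumes "y \<in> H" "\<And>w. w \<in> H \<Longrightarrow> w \<bullet> y = w \<bullet> x"
  shows "proj x = y"
proof -
  have d: "proj x - y \<in> H" using assms(1) proj(1) subspace_H by (simp add: subspace_diff)
  have "(proj x - y) \<bullet> (proj x - y) = 0"
    using proj(2)[OF d, of x] assms(2)[OF d] by (simp add: inner_diff_right)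
  then show ?thesis by simp
qed

lemma linear_proj: "linear proj"
proof (rule linearI)
  show "proj (x + y) = proj x + proj y" for x y
    by (rule proj_unique) (auto simp: inner_add_right proj subspace_add[OF subspace_H])
  show "proj (r *\<^sub>R x) = r *\<^sub>R proj x" for r x
    by (rule proj_unique) (auto simp: proj subspace_scale[OF subspace_H])
qed

text \<open>The hypothesis bounds \<open>v\<close> against integral cycles only. Induction on the
  positive support extends it to all flows, since \<open>l1\<close> is additive when a
  sign-compatible multiple of a cycle is split off.\<close>

lemma inner_le_l1_of_Vor:
  assumes v: "\<And>z. z \<in> H1 G \<iota> \<int> \<Longrightarrow> 2 * (z \<bullet> v) \<le> z \<bullet> z"
    and c: "c \<in> H"
  shows "c \<bullet> v \<le> l1 c / 2"
  using c
proof (induction "card (pos_arcs c)" arbitrary: c rule: less_induct)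
  case less
  show ?case
  proof (cases "c = 0")
    case True
    then show ?thesis by (simp add: l1_def)
  next
    case False
    obtain z where z: "z \<in> H1 G \<iota> \<int>" "z \<noteq> 0" "\<forall>a. z $ a \<in> {-1, 0, 1}" "pos_arcs z \<subseteq> pos_arcs c"
      using ex_cycle_within_support[OF less.prems False] by blast
    have zH: "z \<in> H" using z(1) H1_subset by blast
    note rev = H_reverse[OF less.prems] H_reverse[OF zH]
    have "\<exists>a. a \<in> pos_arcs z"
    proof -
      obtain a where "z $ a \<noteq> 0" using z(2) by (auto simp: vec_eq_iff)
      then have "a \<in> pos_arcs z \<or> \<iota> a \<in> pos_arcs z" using rev(2)[of a] by (auto simp: pos_arcs_def)
      then show ?thesis by blast
    qed
    then have ne: "(\<lambda>a. c $ a) ` pos_arcs z \<noteq> {}" by blast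
    \<comment> \<open>The largest multiple of \<open>z\<close> that can be subtracted without
      reversing a sign; the arc \<open>m\<close> attaining the minimum drops out of the
      support.\<close>
    define t where "t = Min ((\<lambda>a. c $ a) ` pos_arcs z)"
    obtain m where m: "m \<in> pos_arcs z" "t = c $ m"
      using Min_in[OF _ ne] unfolding t_def by auto
    have t_le: "t \<le> c $ a" if "a \<in> pos_arcs z" for a
      unfolding t_def using that by (intro Min_le) auto
    have t_pos: "0 < t" using m z(4) by (auto simp: pos_arcs_def)
    define d where "d = c - t *\<^sub>R z"
    have dH: "d \<in> H"
      unfolding d_def using less.prems zH subspace_H by (intro subspace_diff subspace_scale)
    have d_at: "z $ a = 1 \<and> t \<le> c $ a \<and> d $ a = c $ a - t
        \<or> z $ a = 0 \<and> d $ a = c $ a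
        \<or> z $ a = - 1 \<and> t \<le> - c $ a \<and> d $ a = c $ a + t" for a
      using z(3)[rule_format, of a] t_le[of a] t_le[of "\<iota> a"] rev(1)[of a] rev(2)[of a]
      by (auto simp: d_def pos_arcs_def)
    have "pos_arcs d \<subseteq> pos_arcs c"
    proof
      fix a assume "a \<in> pos_arcs d"
      then show "a \<in> pos_arcs c" using d_at[of a] t_pos by (auto simp: pos_arcs_def)
    qed
    moreover have "m \<in> pos_arcs c" "m \<notin> pos_arcs d"
      using m z(4) t_pos d_at[of m] by (auto simp: pos_arcs_def)
    ultimately have "card (pos_arcs d) < card (pos_arcs c)"
      by (intro psubset_card_mono) auto
    then have IH: "d \<bullet> v \<le> l1 d / 2" using less.hyps dH by blast
    have "\<bar>c $ a\<bar> = \<bar>d $ a\<bar> + t * \<bar>z $ a\<bar>" for a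
      using d_at[of a] t_pos by auto
    then have "l1 c = l1 d + t * l1 z"
      by (simp add: l1_def sum.distrib sum_distrib_left)
    moreover have "z $ a * z $ a = \<bar>z $ a\<bar>" for a using z(3)[rule_format, of a] by auto
    then have "z \<bullet> z = l1 z" by (simp add: l1_def inner_vec_def)
    then have "t * (2 * (z \<bullet> v)) \<le> t * l1 z"
      using v[OF z(1)] t_pos by (intro mult_left_mono) auto
    moreover have "c \<bullet> v = d \<bullet> v + t * (z \<bullet> v)"
      by (simp add: d_def inner_diff_left)
    ultimately show ?thesis using IH by (simp add: field_simps)
  qed
qed

lemma form_le_iff: "form v v \<le> form (v - l) (v - l) \<longleftrightarrow> 2 * (l \<bullet> v) \<le> l \<bullet> l"
  by (auto simp: form_def inner_diff_left inner_diff_right inner_commute)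

text \<open>One inclusion separates a point from the compact convex projected cube and contradicts
  the support bound; the other uses that an integer is at most its square in absolute value.\<close>

lemma Vor_eq_proj_cube: "Vor G \<iota> = proj ` cube"
proof (intro equalityI subsetI)
  fix v assume v: "v \<in> Vor G \<iota>"
  then have vH: "v \<in> H" by (simp add: Vor_def)
  have le: "c \<bullet> v \<le> l1 c / 2" if "c \<in> H" for c
    using v by (intro inner_le_l1_of_Vor that) (auto simp: Vor_def form_le_iff)
  show "v \<in> proj ` cube"
  proof (rule ccontr)
    assume n: "v \<notin> proj ` cube"
    have "compact (proj ` cube)" "convex (proj ` cube)"
      unfolding cube_eq_cbox using linear_proj
      by (auto intro!: compact_continuous_image linear_continuous_on convex_linear_image
          simp: linear_conv_bounded_linear)
    then obtain b k where bk: "b \<bullet> v < k" "\<And>x. x \<in> proj ` cube \<Longrightarrow> k < b \<bullet> x"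
      using separating_hyperplane_closed_point[of "proj ` cube" v] n compact_imp_closed by blast
    \<comment> \<open>On \<open>H\<close> only the projection of \<open>b\<close> matters; the sign
      makes \<open>c\<close> larger at \<open>v\<close> than on the projected cube.\<close>
    define c where "c = - proj b"
    have cH: "c \<in> H" unfolding c_def using proj(1) subspace_H by (simp add: subspace_neg)
    have c: "c \<bullet> w = - (b \<bullet> w)" if "w \<in> H" for w
      using proj(2)[OF that, of b] by (simp add: c_def inner_commute)
    have "k < b \<bullet> proj (sign_vertex c)"
      using bk(2) sign_vertex_in_cube by blast
    also have "\<dots> = - (c \<bullet> sign_vertex c)"
      using c[OF proj(1)] proj(2)[OF cH] by simp
    also have "\<dots> = - (l1 c / 2)" by (simp add: inner_sign_vertex)
    also have "\<dots> \<le> b \<bullet> v" using le[OF cH] c[OF vH] by simp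
    finally show False using bk(1) by simp
  qed
next
  fix v assume "v \<in> proj ` cube"
  then obtain x where x: "x \<in> cube" "v = proj x" by blast
  have "2 * (l \<bullet> v) \<le> l \<bullet> l" if l: "l \<in> H1 G \<iota> \<int>" for l
  proof -
    have "l \<bullet> v = l \<bullet> x" using x proj(2) l H1_subset by blast
    also have "\<dots> \<le> l1 l / 2" by (rule inner_cube_le(1)[OF x(1)])
    finally have "2 * (l \<bullet> v) \<le> l1 l" by simp
    also have "\<dots> \<le> l \<bullet> l"
      unfolding l1_def inner_vec_def
    proof (intro sum_mono)
      fix a
      have "l $ a \<in> \<int>" using l by (auto simp: H1_def chains_def)
      then obtain n where n: "l $ a = of_int n" by (auto elim: Ints_cases)
      have "\<bar>n\<bar> * 1 \<le> \<bar>n\<bar> * \<bar>n\<bar>" by (cases "n = 0") (simp, intro mult_left_mono, auto)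
      then have "\<bar>n\<bar> \<le> n * n" by simp
      then show "\<bar>l $ a\<bar> \<le> l $ a \<bullet> l $ a"
        by (simp add: n flip: of_int_mult of_int_abs)
    qed
    finally show ?thesis .
  qed
  then show "v \<in> Vor G \<iota>" using x proj(1) by (simp add: Vor_def form_le_iff)
qed

section \<open>Faces and normal cones of the Voronoi polytope\<close>

lemma polytope_Vor: "polytope (Vor G \<iota>)"
  unfolding Vor_eq_proj_cube cube_eq_cbox by (intro polytope_linear_image linear_proj polytope_interval)

definition sign_face :: "'e set \<Rightarrow> (real ^ 'e) set" where
  "sign_face P = proj ` {x \<in> cube. \<forall>a\<in>P. x $ a = 1/2 \<and> x $ \<iota> a = - 1/2}"

text \<open>When \<open>P\<close> is the sign pattern of a flow, antisymmetry turns the inclusion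
  into weak inequalities: \<open>c\<close> is nonnegative on \<open>P\<close> and zero on edges
  missed by \<open>P\<close>.\<close>

definition sign_cone :: "'e set \<Rightarrow> (real ^ 'e) set" where
  "sign_cone P = {c \<in> H. pos_arcs c \<subseteq> P}"

lemma inner_Vor_le: "c \<in> H \<Longrightarrow> r \<in> Vor G \<iota> \<Longrightarrow> c \<bullet> r \<le> l1 c / 2"
  using inner_cube_le(1) by (auto simp: Vor_eq_proj_cube proj(2))

text \<open>Projection preserves the pairing with \<open>c\<close>, so maximisers on the polytope
  are the images of maximisers on the cube.\<close>

lemma face_pos_arcs: "c \<in> H \<Longrightarrow> sign_face (pos_arcs c) = Vor G \<iota> \<inter> {r. c \<bullet> r = l1 c / 2}"
  using inner_cube_eq_iff[of c] by (auto simp: sign_face_def Vor_eq_proj_cube proj)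

lemma sign_vertex_face: "c \<in> H \<Longrightarrow> proj (sign_vertex c) \<in> sign_face (pos_arcs c)"
  by (simp add: face_pos_arcs Vor_eq_proj_cube sign_vertex_in_cube proj inner_sign_vertex)

lemma face_antimono: "P \<subseteq> Q \<Longrightarrow> sign_face Q \<subseteq> sign_face P"
  by (auto simp: sign_face_def)

text \<open>If \<open>b\<close> is maximal at the image of \<open>sign_vertex c\<close>, then that
  barycentre has coordinate 1/2 on \<open>pos_arcs b\<close>, which forces \<open>c\<close> to be
  positive there. Conversely, a smaller pattern has a larger face.\<close>

lemma normal_cone_face:
  assumes c: "c \<in> H"
  shows "normal_cone G \<iota> (sign_face (pos_arcs c)) = sign_cone (pos_arcs c)"
proof (intro equalityI subsetI)
  fix b assume b: "b \<in> normal_cone G \<iota> (sign_face (pos_arcs c))"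
  then have bH: "b \<in> H" by (simp add: normal_cone_def)
  have "proj (sign_vertex b) \<in> Vor G \<iota>"
    by (simp add: Vor_eq_proj_cube sign_vertex_in_cube)
  then have "b \<bullet> proj (sign_vertex b) \<le> b \<bullet> proj (sign_vertex c)"
    using b sign_vertex_face[OF c] by (auto simp: normal_cone_def form_def)
  then have "b \<bullet> sign_vertex c = l1 b / 2"
    using inner_cube_le(1)[OF sign_vertex_in_cube, of b c]
    by (simp add: proj(2)[OF bH] inner_sign_vertex)
  then have "sign_vertex c $ a = 1/2" if "a \<in> pos_arcs b" for a
    using that inner_cube_eq_iff[OF bH sign_vertex_in_cube] by blast
  then have "0 < c $ a" if "a \<in> pos_arcs b" for a
    using that by (fastforce simp: sign_vertex_def sgn_real_def split: if_splits)
  then have "pos_arcs b \<subseteq> pos_arcs c" by (auto simp: pos_arcs_def)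
  then show "b \<in> sign_cone (pos_arcs c)" using bH by (simp add: sign_cone_def)
next
  fix b assume "b \<in> sign_cone (pos_arcs c)"
  then have b: "b \<in> H" "pos_arcs b \<subseteq> pos_arcs c" by (auto simp: sign_cone_def)
  have "form b r' \<le> form b r" if "r \<in> sign_face (pos_arcs c)" "r' \<in> Vor G \<iota>" for r r'
  proof -
    have "r \<in> sign_face (pos_arcs b)" using that(1) face_antimono[OF b(2)] by blast
    then have "b \<bullet> r = l1 b / 2" using face_pos_arcs[OF b(1)] by blast
    then show ?thesis using inner_Vor_le[OF b(1) that(2)] by (simp add: form_def)
  qed
  then show "b \<in> normal_cone G \<iota> (sign_face (pos_arcs c))" using b(1) by (simp add: normal_cone_def)
qed

text \<open>Faces of a polytope are exposed. The exposing functional may be projected to some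
  \<open>c\<close> in \<open>H\<close>, and its level must be the maximum
  \<open>l1 c / 2\<close>.\<close>

lemma Vor_faces_eq: "Vor_faces G \<iota> = sign_face ` pos_arcs ` H"
proof (intro equalityI subsetI)
  fix \<delta> assume "\<delta> \<in> Vor_faces G \<iota>"
  then have \<delta>: "\<delta> \<noteq> {}" "\<delta> exposed_face_of Vor G \<iota>"
    by (auto simp: Vor_faces_def exposed_face_of_polyhedron[OF polytope_imp_polyhedron[OF polytope_Vor]])
  obtain b k where bk: "Vor G \<iota> \<subseteq> {x. b \<bullet> x \<le> k}" "\<delta> = Vor G \<iota> \<inter> {x. b \<bullet> x = k}"
    using \<delta>(2) unfolding exposed_face_of_def by blast
  define c where "c = proj b"
  have cH: "c \<in> H" by (simp add: c_def proj)
  have cb: "c \<bullet> w = b \<bullet> w" if "w \<in> Vor G \<iota>" for w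
    using proj(2)[of w b] that by (simp add: c_def inner_commute Vor_def)
  obtain r where r: "r \<in> Vor G \<iota>" "b \<bullet> r = k" using \<delta>(1) bk(2) by blast
  have s: "proj (sign_vertex c) \<in> Vor G \<iota>" by (simp add: Vor_eq_proj_cube sign_vertex_in_cube)
  have "c \<bullet> proj (sign_vertex c) = l1 c / 2" by (simp add: proj(2)[OF cH] inner_sign_vertex)
  then have "k = l1 c / 2"
    using inner_Vor_le[OF cH r(1)] cb[OF r(1)] r(2) cb[OF s] bk(1) s by force
  then have "\<delta> = sign_face (pos_arcs c)" using bk(2) cb by (auto simp: face_pos_arcs[OF cH])
  then show "\<delta> \<in> sign_face ` pos_arcs ` H" using cH by blast
next
  fix \<delta> assume "\<delta> \<in> sign_face ` pos_arcs ` H"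
  then obtain c where c: "c \<in> H" "\<delta> = sign_face (pos_arcs c)" by blast
  have "\<delta> face_of Vor G \<iota>"
    unfolding c(2) face_pos_arcs[OF c(1)]
    by (intro face_of_Int_supporting_hyperplane_le inner_Vor_le polytope_imp_convex polytope_Vor c)
  then show "\<delta> \<in> Vor_faces G \<iota>" using sign_vertex_face[OF c(1)] c(2) by (auto simp: Vor_faces_def)
qed

lemma normal_fan_eq: "normal_fan G \<iota> = sign_cone ` pos_arcs ` H"
  unfolding normal_fan_def Vor_faces_eq image_image by (intro image_cong normal_cone_face refl)

lemma cone_subset_iff:
  assumes "P \<in> pos_arcs ` H"
  shows "sign_cone P \<subseteq> sign_cone Q \<longleftrightarrow> P \<subseteq> Q"
  using assms by (auto simp: sign_cone_def)

text \<open>Passing to normal cones reverses inclusion and recovers the sign pattern from the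
  face.\<close>

lemma face_subset_iff:
  assumes "P \<in> pos_arcs ` H" "Q \<in> pos_arcs ` H"
  shows "sign_face P \<supseteq> sign_face Q \<longleftrightarrow> P \<subseteq> Q"
proof
  assume sub: "sign_face Q \<subseteq> sign_face P"
  have "normal_cone G \<iota> (sign_face P) \<subseteq> normal_cone G \<iota> (sign_face Q)"
    using sub by (auto simp: normal_cone_def)
  then have "sign_cone P \<subseteq> sign_cone Q" using assms normal_cone_face by auto
  then show "P \<subseteq> Q" using cone_subset_iff[OF assms(1)] by simp
qed (rule face_antimono)

lemma faces_isomorphic: "poset_isomorphic (pos_arcs ` H) (\<subseteq>) (Vor_faces G \<iota>) (\<supseteq>)"
  by (rule poset_isomorphicI[where f = sign_face]) (auto simp: Vor_faces_eq face_subset_iff)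

lemma cones_isomorphic: "poset_isomorphic (pos_arcs ` H) (\<subseteq>) (normal_fan G \<iota>) (\<subseteq>)"
  by (rule poset_isomorphicI[where f = sign_cone]) (auto simp: normal_fan_eq cone_subset_iff)


section \<open>The cographic fan\<close>

text \<open>A description by maximal sign patterns alone; \<open>arrangement_complement\<close>
  identifies these flows as the ones off all hyperplanes.\<close>

definition general_flows :: "(real ^ 'e) set" where
  "general_flows = {v \<in> H. \<forall>w\<in>H. pos_arcs v \<subseteq> pos_arcs w \<longrightarrow> pos_arcs w \<subseteq> pos_arcs v}"

lemma form_dart_H: "v \<in> H \<Longrightarrow> form v (dart \<iota> a) = v $ a"
  by (simp add: form_def dart_def inner_diff_right inner_axis H_reverse)

lemma nonzero_iff_pos: "v \<in> H \<Longrightarrow> v $ a \<noteq> 0 \<longleftrightarrow> a \<in> pos_arcs v \<or> \<iota> a \<in> pos_arcs v"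
  using H_reverse[of v a] by (auto simp: pos_arcs_def)

text \<open>A small step keeps the finitely many positive coordinates positive, while
  \<open>w\<close> decides the sign where \<open>v\<close> vanishes.\<close>

lemma perturbed_flow:
  assumes v: "v \<in> H" and w: "w \<in> H"
  obtains e where "0 < e" "v + e *\<^sub>R w \<in> H" "pos_arcs v \<subseteq> pos_arcs (v + e *\<^sub>R w)"
    "\<And>a. v $ a = 0 \<Longrightarrow> a \<in> pos_arcs w \<Longrightarrow> a \<in> pos_arcs (v + e *\<^sub>R w)"
proof -
  have "\<forall>a\<in>pos_arcs v. \<forall>\<^sub>F e in at_right 0. 0 < v $ a + e * w $ a"
  proof
    fix a assume "a \<in> pos_arcs v"
    moreover have "((\<lambda>e. v $ a + e * w $ a) \<longlongrightarrow> v $ a + 0 * w $ a) (at_right 0)"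
      by (intro tendsto_intros)
    ultimately show "\<forall>\<^sub>F e in at_right 0. 0 < v $ a + e * w $ a"
      by (intro order_tendstoD(1)[where y = "v $ a"]) (auto simp: pos_arcs_def)
  qed
  then have "\<forall>\<^sub>F e in at_right 0. \<forall>a\<in>pos_arcs v. 0 < v $ a + e * w $ a"
    by (simp add: eventually_ball_finite)
  moreover have "\<forall>\<^sub>F e in at_right (0::real). 0 < e"
    by (simp add: eventually_at_right_less)
  ultimately have "\<exists>e>0. \<forall>a\<in>pos_arcs v. 0 < v $ a + e * w $ a"
    using eventually_happens[OF eventually_conj] trivial_limit_at_right_real by blast
  then obtain e where e: "0 < e" "\<forall>a\<in>pos_arcs v. 0 < v $ a + e * w $ a" by blast
  show thesis
  proof (rule that[OF e(1)])
    show "v + e *\<^sub>R w \<in> H" using assms subspace_H by (intro subspace_add subspace_scale)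
  qed (use e in \<open>auto simp: pos_arcs_def zero_less_mult_iff\<close>)
qed

lemma Union_arrangement:
  "\<Union>(cographic_arrangement G \<iota>) = {v \<in> H. \<exists>a. v $ a = 0 \<and> (\<exists>w\<in>H. w $ a \<noteq> 0)}"
proof (intro equalityI subsetI)
  fix v assume "v \<in> \<Union>(cographic_arrangement G \<iota>)"
  then obtain a w where "v \<in> H" "form v (dart \<iota> a) = 0" "w \<in> H" "form w (dart \<iota> a) \<noteq> 0"
    unfolding cographic_arrangement_def by blast
  then show "v \<in> {v \<in> H. \<exists>a. v $ a = 0 \<and> (\<exists>w\<in>H. w $ a \<noteq> 0)}"
    by (auto simp: form_dart_H)
next
  fix v assume "v \<in> {v \<in> H. \<exists>a. v $ a = 0 \<and> (\<exists>w\<in>H. w $ a \<noteq> 0)}"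
  then obtain a w where "v \<in> H" "v $ a = 0" "w \<in> H" "w $ a \<noteq> 0" by blast
  moreover from this have "a \<in> arcs G" using chain_support[OF H_in_chains] by blast
  ultimately have "a \<in> arcs G" "v \<in> H" "form v (dart \<iota> a) = 0" "w \<in> H" "form w (dart \<iota> a) \<noteq> 0"
    by (simp_all add: form_dart_H)
  then show "v \<in> \<Union>(cographic_arrangement G \<iota>)"
    unfolding cographic_arrangement_def by blast
qed

text \<open>A flow that is nonzero wherever some flow is has no room for a larger pattern.
  Otherwise, perturbing it by a flow nonzero at the missing edge enlarges its pattern.\<close>

lemma arrangement_complement:
  "H - \<Union>(cographic_arrangement G \<iota>) = general_flows"
  unfolding Union_arrangement
proof (intro equalityI subsetI)
  fix v assume "v \<in> H - {v \<in> H. \<exists>a. v $ a = 0 \<and> (\<exists>w\<in>H. w $ a \<noteq> 0)}"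
  then have v: "v \<in> H" and nz: "\<And>w a. w \<in> H \<Longrightarrow> w $ a \<noteq> 0 \<Longrightarrow> v $ a \<noteq> 0" by auto
  show "v \<in> general_flows"
    unfolding general_flows_def
  proof (intro CollectI conjI ballI impI subsetI v)
    fix w a assume w: "w \<in> H" "pos_arcs v \<subseteq> pos_arcs w" "a \<in> pos_arcs w"
    then have "v $ a \<noteq> 0" using nz[OF w(1), of a] by (simp add: pos_arcs_def)
    moreover have "\<iota> a \<notin> pos_arcs v"
      using w H_reverse[OF w(1), of a] by (auto simp: pos_arcs_def)
    ultimately show "a \<in> pos_arcs v" using nonzero_iff_pos[OF v] by blast
  qed
next
  fix v assume "v \<in> general_flows"
  then have v: "v \<in> H" and max: "\<And>w. w \<in> H \<Longrightarrow> pos_arcs v \<subseteq> pos_arcs w \<Longrightarrow> pos_arcs w \<subseteq> pos_arcs v"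
    by (auto simp: general_flows_def)
  have "v $ a \<noteq> 0" if w: "w \<in> H" "w $ a \<noteq> 0" for w a
  proof
    assume z: "v $ a = 0"
    then have z': "v $ \<iota> a = 0" using H_reverse[OF v] by simp
    obtain e where e: "v + e *\<^sub>R w \<in> H" "pos_arcs v \<subseteq> pos_arcs (v + e *\<^sub>R w)"
      "\<And>a. v $ a = 0 \<Longrightarrow> a \<in> pos_arcs w \<Longrightarrow> a \<in> pos_arcs (v + e *\<^sub>R w)"
      by (rule perturbed_flow[OF v w(1)]) simp
    have "a \<in> pos_arcs v \<or> \<iota> a \<in> pos_arcs v"
      using nonzero_iff_pos[OF w(1), of a] w(2) e(3)[of a] e(3)[of "\<iota> a"] z z' max[OF e(1,2)] by blast
    then show False using z z' by (auto simp: pos_arcs_def)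
  qed
  then show "v \<in> H - {v \<in> H. \<exists>a. v $ a = 0 \<and> (\<exists>w\<in>H. w $ a \<noteq> 0)}"
    using v by blast
qed

lemma ex_max_pos_arcs:
  assumes "P c"
  shows "\<exists>v :: real ^ 'e. P v \<and> (\<forall>w. P w \<longrightarrow> card (pos_arcs w) \<le> card (pos_arcs v))"
  using assms
  \<comment> \<open>The \<open>Suc\<close> makes the bound on the cardinalities strict.\<close>
  by (rule ex_has_greatest_nat[where b = "Suc CARD('e)"]) (auto simp: less_Suc_eq_le intro: card_mono)

lemma ex_general_flow:
  assumes "c \<in> H"
  shows "\<exists>v\<in>general_flows. pos_arcs c \<subseteq> pos_arcs v"
proof -
  define ok where "ok w \<longleftrightarrow> w \<in> H \<and> pos_arcs c \<subseteq> pos_arcs w" for w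
  have "ok c" using assms by (simp add: ok_def)
  then obtain v where v: "ok v" "\<And>w. ok w \<Longrightarrow> card (pos_arcs w) \<le> card (pos_arcs v)"
    using ex_max_pos_arcs[of ok c] by auto
  have "pos_arcs w \<subseteq> pos_arcs v" if w: "w \<in> H" "pos_arcs v \<subseteq> pos_arcs w" for w
  proof -
    have "ok w" using w v(1) by (auto simp: ok_def)
    then show ?thesis using card_seteq[OF _ w(2)] v(2) by simp
  qed
  then have "v \<in> general_flows" using v(1) by (simp add: general_flows_def ok_def)
  then show ?thesis using v(1) by (auto simp: ok_def)
qed

section \<open>Sign cones and their faces\<close>

text \<open>Two flows in one sign cone never have opposite signs at an arc, so positive combinations
  do not cancel.\<close>

lemma pos_arcs_combination_cone:
  assumes "a \<in> sign_cone P" "b \<in> sign_cone P" "P \<in> pos_arcs ` H" "0 < s" "0 < t"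
  shows "s *\<^sub>R a + t *\<^sub>R b \<in> H" "pos_arcs (s *\<^sub>R a + t *\<^sub>R b) = pos_arcs a \<union> pos_arcs b"
proof -
  have ab: "a \<in> H" "b \<in> H" "pos_arcs a \<subseteq> P" "pos_arcs b \<subseteq> P" using assms by (auto simp: sign_cone_def)
  show "s *\<^sub>R a + t *\<^sub>R b \<in> H" using ab subspace_H by (intro subspace_add subspace_scale)
  obtain p where p: "p \<in> H" "P = pos_arcs p" using assms(3) by blast
  have nonneg: "0 \<le> w $ e" if "w \<in> H" "pos_arcs w \<subseteq> P" "e \<in> P" for w e
  proof -
    have "\<iota> e \<notin> P" using that(3) H_reverse[OF p(1), of e] by (auto simp: p(2) pos_arcs_def)
    then have "\<not> 0 < w $ \<iota> e" using that(2) by (auto simp: pos_arcs_def)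
    then show ?thesis using H_reverse[OF that(1), of e] by simp
  qed
  have "e \<in> pos_arcs (s *\<^sub>R a + t *\<^sub>R b) \<longleftrightarrow> e \<in> pos_arcs a \<or> e \<in> pos_arcs b" for e
  proof (cases "e \<in> P")
    case True
    then have "0 \<le> s * a $ e" "0 \<le> t * b $ e" using nonneg ab assms(4,5) by simp_all
    then have "0 < s * a $ e + t * b $ e \<longleftrightarrow> 0 < s * a $ e \<or> 0 < t * b $ e" by linarith
    then show ?thesis using assms(4,5) by (simp add: pos_arcs_def zero_less_mult_iff)
  next
    case False
    then have "a $ e \<le> 0" "b $ e \<le> 0" "e \<notin> pos_arcs a" "e \<notin> pos_arcs b"
      using ab(3,4) by (auto simp: pos_arcs_def not_less[symmetric])
    moreover from this have "s * a $ e \<le> 0" "t * b $ e \<le> 0"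
      using assms(4,5) by (simp_all add: mult_nonneg_nonpos)
    ultimately show ?thesis by (simp add: pos_arcs_def)
  qed
  then show "pos_arcs (s *\<^sub>R a + t *\<^sub>R b) = pos_arcs a \<union> pos_arcs b" by blast
qed

lemma convex_cone: "convex (sign_cone P)"
proof (rule convexI)
  fix x y :: "real ^ 'e" and u v :: real
  assume xy: "x \<in> sign_cone P" "y \<in> sign_cone P" and uv: "0 \<le> u" "0 \<le> v" "u + v = 1"
  have "0 < x $ e \<or> 0 < y $ e" if "0 < u * x $ e + v * y $ e" for e
    using that uv mult_nonneg_nonpos[of u "x $ e"] mult_nonneg_nonpos[of v "y $ e"]
    by (meson add_nonpos_nonpos not_less)
  then show "u *\<^sub>R x + v *\<^sub>R y \<in> sign_cone P"
    using xy subspace_H by (auto simp: sign_cone_def pos_arcs_def subspace_add subspace_scale)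
qed

text \<open>An inner point of a segment has the union of the patterns of its end points; if this
  lies in \<open>Q\<close>, so do both patterns.\<close>

lemma cone_face_of_cone:
  assumes P: "P \<in> pos_arcs ` H" and Q: "Q \<subseteq> P"
  shows "sign_cone Q face_of sign_cone P"
  unfolding face_of_def
proof (intro conjI ballI impI)
  show "sign_cone Q \<subseteq> sign_cone P" using Q by (auto simp: sign_cone_def)
  fix a b x assume ab: "a \<in> sign_cone P" "b \<in> sign_cone P" and x: "x \<in> sign_cone Q" "x \<in> open_segment a b"
  obtain u where u: "0 < u" "u < 1" "x = (1 - u) *\<^sub>R a + u *\<^sub>R b"
    using x(2) by (auto simp: in_segment)
  have "pos_arcs x = pos_arcs a \<union> pos_arcs b"
    unfolding u(3) using u by (intro pos_arcs_combination_cone(2)[OF ab P]) auto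
  then show "a \<in> sign_cone Q" "b \<in> sign_cone Q" using ab x(1) by (auto simp: sign_cone_def)
qed (rule convex_cone)

lemma face_of_cone_is_cone:
  assumes P: "P \<in> pos_arcs ` H" and F: "F face_of sign_cone P" "F \<noteq> {}"
  shows "\<exists>c\<in>H. pos_arcs c \<subseteq> P \<and> F = sign_cone (pos_arcs c)"
proof -
  have sub: "F \<subseteq> sign_cone P" and "convex F" using F(1) by (auto simp: face_of_def)
  obtain w where w: "w \<in> F" using F(2) by blast
  txt \<open>Signs cannot cancel inside a cone, so a flow in \<open>F\<close> of largest support has all
    others below it, and lies in the relative interior of its cone.\<close>
  obtain x where x: "x \<in> F" "\<And>w. w \<in> F \<Longrightarrow> card (pos_arcs w) \<le> card (pos_arcs x)"
    using ex_max_pos_arcs[of "\<lambda>w. w \<in> F" w] w by auto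
  have xH: "x \<in> H" "pos_arcs x \<subseteq> P" using x(1) sub by (auto simp: sign_cone_def)
  have "y \<in> sign_cone (pos_arcs x)" if y: "y \<in> F" for y
  proof -
    let ?m = "(1/2) *\<^sub>R x + (1/2) *\<^sub>R y"
    have "?m \<in> F" using \<open>convex F\<close> x(1) y by (intro convexD) auto
    moreover have "pos_arcs ?m = pos_arcs x \<union> pos_arcs y"
      using x(1) y sub by (intro pos_arcs_combination_cone(2)[OF _ _ P]) auto
    ultimately have "pos_arcs x = pos_arcs x \<union> pos_arcs y"
      using x(2)[of ?m] by (intro card_seteq) auto
    then show ?thesis using y sub by (auto simp: sign_cone_def)
  qed
  moreover have "y \<in> F" if y: "y \<in> sign_cone (pos_arcs x)" for y
  proof (cases "y = x")
    case False
    have yH: "y \<in> H" "pos_arcs y \<subseteq> pos_arcs x" using y by (auto simp: sign_cone_def)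
    \<comment> \<open>Prolonging the segment from \<open>y\<close> slightly beyond \<open>x\<close>
      stays in the cone, so the face property at \<open>x\<close> puts \<open>y\<close> into
      \<open>F\<close>.\<close>
    obtain e where e: "0 < e" "x + e *\<^sub>R (x - y) \<in> H"
      and ge: "pos_arcs x \<subseteq> pos_arcs (x + e *\<^sub>R (x - y))"
      using perturbed_flow[OF xH(1) subspace_diff[OF subspace_H xH(1) yH(1)]] .
    let ?z = "x + e *\<^sub>R (x - y)"
    \<comment> \<open>Where \<open>x\<close> vanishes on an edge, so does \<open>y\<close>; hence
      \<open>?z\<close> acquires no new sign.\<close>
    have "pos_arcs ?z \<subseteq> pos_arcs x"
    proof (rule subsetI, rule ccontr)
      fix a assume a: "a \<in> pos_arcs ?z" "a \<notin> pos_arcs x"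
      have "\<iota> a \<notin> pos_arcs ?z" using a(1) H_reverse[OF e(2), of a] by (simp add: pos_arcs_def)
      then have "x $ a = 0" using a(2) ge nonzero_iff_pos[OF xH(1), of a] by blast
      moreover from this have "x $ \<iota> a = 0" using H_reverse[OF xH(1)] by simp
      then have "y $ a = 0"
        using yH a(2) nonzero_iff_pos[OF yH(1), of a] by (auto simp: pos_arcs_def)
      ultimately show False using a(1) by (simp add: pos_arcs_def)
    qed
    then have "?z \<in> sign_cone P" "y \<in> sign_cone P" using e(2) xH yH by (auto simp: sign_cone_def)
    moreover have "x \<in> open_segment y ?z"
    proof -
      \<comment> \<open>The weight of \<open>?z\<close> that places \<open>x\<close> on the segment
        from \<open>y\<close> to \<open>?z\<close>.\<close>
      define s where "s = 1 / (1 + e)"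
      have s: "0 < s" "s < 1" "s * (1 + e) = 1" using e(1) by (simp_all add: s_def)
      have "(1 - s) *\<^sub>R y + s *\<^sub>R ?z = (1 - s * (1 + e)) *\<^sub>R y + (s * (1 + e)) *\<^sub>R x"
        by (simp add: algebra_simps)
      then have "x = (1 - s) *\<^sub>R y + s *\<^sub>R ?z" by (simp add: s(3))
      moreover have "y \<noteq> ?z"
      proof
        assume "y = ?z"
        then have "(1 + e) *\<^sub>R (x - y) = 0" by (simp add: algebra_simps)
        then show False using e(1) False by simp
      qed
      ultimately show ?thesis
        using s(1,2) unfolding in_segment by (intro conjI exI[of _ s]) auto
    qed
    ultimately show ?thesis using F(1) x(1) unfolding face_of_def by blast
  qed (use x in simp)
  ultimately show ?thesis using xH by blast
qed

section \<open>Chambers of the cographic arrangement and their closures\<close>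

lemma closed_H: "closed H"
  using subspace_H by (rule closed_subspace)

lemma closed_cone: "closed (sign_cone P)"
proof -
  have "sign_cone P = H \<inter> (\<Inter>a\<in>- P. {c. c $ a \<le> 0})"
    by (auto simp: sign_cone_def pos_arcs_def not_less[symmetric])
  then show ?thesis
    using closed_H by (auto intro!: closed_Int closed_INT closed_halfspace_component_le_cart)
qed

text \<open>Adding a small positive multiple of \<open>v\<close> gives any flow in the cone exactly
  the pattern of \<open>v\<close>.\<close>

lemma closure_chamber:
  assumes v: "v \<in> H"
  shows "closure {w \<in> H. pos_arcs w = pos_arcs v} = sign_cone (pos_arcs v)" (is "closure ?U = _")
proof (intro equalityI closure_minimal closed_cone subsetI)
  show "w \<in> sign_cone (pos_arcs v)" if "w \<in> ?U" for w using that by (simp add: sign_cone_def)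
  fix w assume w: "w \<in> sign_cone (pos_arcs v)"
  have vc: "v \<in> sign_cone (pos_arcs v)" using v by (simp add: sign_cone_def)
  have mem: "w + t *\<^sub>R v \<in> ?U" if "0 < t" for t
    using pos_arcs_combination_cone[OF w vc _ zero_less_one that] v w by (auto simp: sign_cone_def)
  have "((\<lambda>t. w + t *\<^sub>R v) \<longlongrightarrow> w + 0 *\<^sub>R v) (at_right 0)"
    by (intro tendsto_intros)
  moreover have "\<forall>\<^sub>F t in at_right 0. w + t *\<^sub>R v \<in> closure ?U"
    using mem closure_subset by (intro eventually_at_right_less[THEN eventually_mono]) blast
  ultimately have "w + 0 *\<^sub>R v \<in> closure ?U"
    by (intro Lim_in_closed_set[OF closed_closure]) auto
  then show "w \<in> closure ?U" by simp
qed

text \<open>Flows with one pattern form a convex set. Conversely, a sign change within a connected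
  set forces a zero by the intermediate value property, and so a point on a hyperplane.\<close>

lemma chamber:
  assumes v: "v \<in> general_flows"
  shows "connected_component_set general_flows v = {w \<in> H. pos_arcs w = pos_arcs v}" (is "_ = ?U")
proof (intro equalityI connected_component_maximal)
  have vH: "v \<in> H" using v by (simp add: general_flows_def)
  then show "v \<in> ?U" by simp
  show "?U \<subseteq> general_flows" using v by (auto simp: general_flows_def)
  have "convex ?U"
  proof (rule convexI)
    fix x y :: "real ^ 'e" and s t :: real
    assume xy: "x \<in> ?U" "y \<in> ?U" and st: "0 \<le> s" "0 \<le> t" "s + t = 1"
    show "s *\<^sub>R x + t *\<^sub>R y \<in> ?U"
    \<comment> \<open>The combination lemma requires both coefficients to be positive.\<close>
    proof (cases "s = 0 \<or> t = 0")
      case True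
      then show ?thesis using xy st by auto
    next
      case False
      then show ?thesis
        using pos_arcs_combination_cone[of x "pos_arcs v" y s t] xy st vH by (auto simp: sign_cone_def)
    qed
  qed
  then show "Topological_Spaces.connected ?U" by (rule convex_connected)
  show "connected_component_set general_flows v \<subseteq> ?U"
  proof
    fix w assume "w \<in> connected_component_set general_flows v"
    then obtain T where T: "Topological_Spaces.connected T" "T \<subseteq> general_flows" "v \<in> T" "w \<in> T"
      by (auto simp: connected_component_def)
    then have wH: "w \<in> H" by (auto simp: general_flows_def)
    have pos: "a \<in> pos_arcs y" if xy: "x \<in> T" "y \<in> T" "a \<in> pos_arcs x" for x y a
    proof (rule ccontr)
      assume n: "a \<notin> pos_arcs y"
      have "\<exists>z\<in>T. z $ a = 0"
        using connected_ivt_component_cart[OF T(1) xy(2,1), of a 0] xy n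
        by (auto simp: pos_arcs_def)
      then obtain z where z: "z \<in> T" "z $ a = 0" by blast
      then have "z \<in> H - \<Union>(cographic_arrangement G \<iota>)" and "x \<in> H"
        using xy(1) T(2) unfolding arrangement_complement by (auto simp: general_flows_def)
      moreover have "x $ a \<noteq> 0" using xy(3) by (simp add: pos_arcs_def)
      ultimately show False using z(2) unfolding Union_arrangement by blast
    qed
    have "pos_arcs w = pos_arcs v" using pos T(3,4) by blast
    then show "w \<in> ?U" using wH by simp
  qed
qed

text \<open>Every pattern extends to a maximal one, so each sign cone is a face of a closed chamber;
  faces of closed chambers are sign cones again.\<close>

lemma cographic_fan_eq: "cographic_fan G \<iota> = sign_cone ` pos_arcs ` H"
proof -
  have closure_eq: "closure (connected_component_set general_flows v) = sign_cone (pos_arcs v)"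
    if "v \<in> general_flows" for v
    using that chamber closure_chamber by (simp add: general_flows_def)
  have fan: "F \<in> cographic_fan G \<iota> \<longleftrightarrow> F \<noteq> {} \<and> (\<exists>v\<in>general_flows. F face_of sign_cone (pos_arcs v))" for F
    unfolding cographic_fan_def arrangement_complement components_def using closure_eq by auto
  have cones: "F \<noteq> {} \<and> (\<exists>v\<in>general_flows. F face_of sign_cone (pos_arcs v)) \<longleftrightarrow> F \<in> sign_cone ` pos_arcs ` H" for F
  proof
    assume "F \<noteq> {} \<and> (\<exists>v\<in>general_flows. F face_of sign_cone (pos_arcs v))"
    then obtain v where "v \<in> H" "F face_of sign_cone (pos_arcs v)" "F \<noteq> {}"
      by (auto simp: general_flows_def)
    then show "F \<in> sign_cone ` pos_arcs ` H"
      using face_of_cone_is_cone[of "pos_arcs v" F] by blast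
  next
    assume "F \<in> sign_cone ` pos_arcs ` H"
    then obtain c where c: "c \<in> H" "F = sign_cone (pos_arcs c)" by blast
    obtain v where v: "v \<in> general_flows" "pos_arcs c \<subseteq> pos_arcs v"
      using ex_general_flow[OF c(1)] by blast
    have "F face_of sign_cone (pos_arcs v)"
      unfolding c(2) using v by (intro cone_face_of_cone) (auto simp: general_flows_def)
    moreover have "c \<in> F" using c by (simp add: sign_cone_def)
    ultimately show "F \<noteq> {} \<and> (\<exists>v\<in>general_flows. F face_of sign_cone (pos_arcs v))" using v by blast
  qed
  show ?thesis by (intro set_eqI) (rule trans[OF fan cones])
qed

end

theorem corollary3p9:
  fixes \<Gamma> :: "('v, 'e::finite) pre_digraph" and \<iota> :: "'e \<Rightarrow> 'e"
  assumes "fin_digraph \<Gamma>" and "bidirected_digraph \<Gamma> \<iota>"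
  shows "poset_isomorphic (OP \<Gamma> \<iota>) (OP_le \<Gamma> \<iota>) (Vor_faces \<Gamma> \<iota>) (\<supseteq>) \<and>
         poset_isomorphic (Vor_faces \<Gamma> \<iota>) (\<supseteq>) (normal_fan \<Gamma> \<iota>) (\<subseteq>) \<and>
         poset_isomorphic (normal_fan \<Gamma> \<iota>) (\<subseteq>) (cographic_fan \<Gamma> \<iota>) (\<subseteq>)"
proof -
  interpret finite_bidirected_graph \<Gamma> \<iota>
    using assms by (simp add: finite_bidirected_graph_def)
  \<comment> \<open>Both fans are the same set of sign cones, so the identity serves.\<close>
  have "poset_isomorphic (normal_fan \<Gamma> \<iota>) (\<subseteq>) (cographic_fan \<Gamma> \<iota>) (\<subseteq>)"
    unfolding normal_fan_eq cographic_fan_eq by (rule poset_isomorphicI[where f = id]) auto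
  then show ?thesis
    using poset_isomorphic_trans[OF OP_isomorphic faces_isomorphic]
      poset_isomorphic_trans[OF poset_isomorphic_sym[OF faces_isomorphic] cones_isomorphic]
    by blast
qed

end
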